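(* Let $q<p\le 2$, and assume that $a\ge q(1-q)$ in the case $p=2$. Suppose that there exists $K_1>0$ such that $t\,\dot\delta(t)<K_1\,\delta(t)$ for all $t$ big enough. Let $x:[t_0,+\infty)\to\mathcal X$ be the unique global solution of the system (DS) given in the context. Then, for any $x^*\in\operatorname{argmin} g$, the following hold. (i) If $2q<p\le 2$, then, as $t\to+\infty$, $g(x(t))-g(x^* )=\mathcal O\left(\frac{1}{\delta(t)t^{2q}}\right)$ and $\|\dot x(t)+\beta\nabla g(x(t))\|=\mathcal O\left(\frac{1}{t^{q}}\right)$. (ii) If $q<p\le 2q$, then, as $t\to+\infty$, $g(x(t))-g(x^* )=\mathcal O\left(\frac{1}{\delta(t)t^{p}}\right)$ and $\|\dot x(t)+\beta\nabla g(x(t))\|=\mathcal O\left(\frac{1}{t^{p/2}}\right)$.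
   Context: $\mathcal X$ is a real Hilbert space with inner product $\langle\cdot,\cdot\rangle$ and norm $\|\cdot\|$. $g:\mathcal X\to\mathbb R$ is a convex, twice differentiable function, and $\operatorname{argmin} g$ is its set of minimizers. The parameters satisfy $t_0>0$, $\alpha,\beta,a,p>0$, $0<q<1$. The time scaling function $\delta:[t_0,+\infty)\to(0,+\infty)$ is differentiable and non-decreasing with $\lim_{t\to+\infty}\delta(t)=+\infty$. The system (DS) is $$\ddot x(t)+\frac{\alpha}{t^q}\dot x(t)+\beta\nabla^2 g(x(t))\dot x(t)+\delta(t)\nabla g(x(t))+\frac{a}{t^p}x(t)=0,\qquad t\ge t_0.$$ A (strong) global solution is a function $x:[t_0,+\infty)\to\mathcal X$ with $x$ and $\dot x$ locally absolutely continuous, satisfying the equation for almost every $t\ge t_0$, with prescribed initial data $(x(t_0),\dot x(t_0))\in\mathcal X\times\mathcal X$. *)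

theory Defs
  imports "HOL-Analysis.Analysis" "HOL-Library.Landau_Symbols"
begin

text \<open>The gradient is the Riesz representative of the Frechet derivative, and the Hessian is the
  Frechet derivative of the gradient map, a bounded linear operator.\<close>

definition gradient :: "('a::real_inner \<Rightarrow> real) \<Rightarrow> 'a \<Rightarrow> 'a" where
  "gradient g x = (THE D. GDERIV g x :> D)"

definition hessian :: "('a::real_inner \<Rightarrow> real) \<Rightarrow> 'a \<Rightarrow> 'a \<Rightarrow> 'a" where
  "hessian g x = frechet_derivative (gradient g) (at x)"

definition twice_differentiable :: "('a::real_inner \<Rightarrow> real) \<Rightarrow> bool" where
  "twice_differentiable g \<longleftrightarrow>
     (\<forall>x. g differentiable (at x)) \<and> (\<forall>x. gradient g differentiable (at x))"

definition argmin :: "('a \<Rightarrow> real) \<Rightarrow> 'a set" where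
  "argmin g = {x. is_arg_min g (\<lambda>_. True) x}"

text \<open>The usual epsilon-delta definition; a finite family of non-overlapping compact subintervals
  is a division \<open>D\<close> of its union \<open>S\<close>, and \<open>k\<close> in \<open>D\<close> is the interval from \<open>Inf k\<close> to \<open>Sup k\<close>.\<close>

definition abs_continuous_on :: "real \<Rightarrow> real \<Rightarrow> (real \<Rightarrow> 'a::real_normed_vector) \<Rightarrow> bool" where
  "abs_continuous_on c d f \<longleftrightarrow>
     (\<forall>\<epsilon>>0. \<exists>\<eta>>0. \<forall>D S. D division_of S \<and> S \<subseteq> {c..d} \<and>
        (\<Sum>k\<in>D. Sup k - Inf k) < \<eta> \<longrightarrow> (\<Sum>k\<in>D. norm (f (Sup k) - f (Inf k))) < \<epsilon>)"

definition locally_abs_continuous_from :: "real \<Rightarrow> (real \<Rightarrow> 'a::real_normed_vector) \<Rightarrow> bool" where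
  "locally_abs_continuous_from t0 f \<longleftrightarrow> (\<forall>T\<ge>t0. abs_continuous_on t0 T f)"

text \<open>The derivative of a function on \<open>{t0..}\<close>: one-sided at \<open>t0\<close>, two-sided at every other point.
  Functions on \<open>{t0..}\<close> are represented by total functions whose values before \<open>t0\<close> are
  irrelevant.\<close>

definition dot :: "real \<Rightarrow> (real \<Rightarrow> 'a::real_normed_vector) \<Rightarrow> real \<Rightarrow> 'a" where
  "dot t0 f t = vector_derivative f (at t within {t0..})"

text \<open>A locally absolutely continuous \<open>x\<close> whose velocity is locally absolutely continuous is
  differentiable at every point of \<open>{t0..}\<close>, whereas the acceleration exists only almost
  everywhere.  The arguments \<open>x0\<close>, \<open>v0\<close> are the initial data.\<close>

definition global_solution ::
  "('a::{real_inner,complete_space} \<Rightarrow> real) \<Rightarrow> (real \<Rightarrow> real) \<Rightarrow>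
   real \<Rightarrow> real \<Rightarrow> real \<Rightarrow> real \<Rightarrow> real \<Rightarrow> real \<Rightarrow> 'a \<Rightarrow> 'a \<Rightarrow> (real \<Rightarrow> 'a) \<Rightarrow> bool" where
  "global_solution g \<delta> \<alpha> \<beta> a p q t0 x0 v0 x \<longleftrightarrow>
     locally_abs_continuous_from t0 x \<and>
     (\<forall>t\<ge>t0. x differentiable (at t within {t0..})) \<and>
     locally_abs_continuous_from t0 (dot t0 x) \<and>
     x t0 = x0 \<and> dot t0 x t0 = v0 \<and>
     (AE t in lebesgue. t \<ge> t0 \<longrightarrow>
        dot t0 x differentiable (at t within {t0..}) \<and>
        dot t0 (dot t0 x) t + (\<alpha> / t powr q) *\<^sub>R dot t0 x t
          + \<beta> *\<^sub>R hessian g (x t) (dot t0 x t) + \<delta> t *\<^sub>R gradient g (x t)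
          + (a / t powr p) *\<^sub>R x t = 0)"

end

theory Submission
  imports Defs
begin

text \<open>The velocity-gradient combination \<open>u = x' + \<beta> \<nabla>g(x)\<close> turns (DS) into the first-order equation
  \<open>u' = - \<alpha> t\<^sup>-\<^sup>q x' - \<delta> \<nabla>g(x) - a t\<^sup>-\<^sup>p x\<close> with a continuous right-hand side, which holds almost
  everywhere.  As \<open>u\<close> is the sum of an absolutely continuous and an everywhere differentiable
  function, it holds at every \<open>t > t0\<close>, although \<open>\<nabla>\<^sup>2g\<close> need not be locally bounded.

  With \<open>r = q\<close> in case (i), \<open>r = p / 2\<close> in case (ii) and \<open>b \<sim> (\<alpha> / 2) t\<^sup>r\<^sup>-\<^sup>q\<close>, the energy
  \<open>E = c (g(x) - g(x*)) + \<parallel>b (x - x*) + t\<^sup>r u\<parallel>\<^sup>2 / 2 + (a / 2) t\<^sup>2\<^sup>r\<^sup>-\<^sup>p \<parallel>x\<parallel>\<^sup>2 + (\<xi> / 2) \<parallel>x - x*\<parallel>\<^sup>2\<close>, where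
  \<open>c \<sim> t\<^sup>2\<^sup>r \<delta>\<close> and \<open>\<xi>\<close> cancels the cross term \<open>\<langle>x - x*, x'\<rangle>\<close>, eventually satisfies
  \<open>E' \<le> t\<^sup>2\<^sup>r\<^sup>-\<^sup>p\<^sup>-\<^sup>q (M - \<kappa> E)\<close>.  So \<open>E\<close> is bounded, which gives both rates.\<close>

subsection \<open>Gradients in Hilbert space\<close>

text \<open>The representing vector is the minimizer of \<open>J y = |y|^2 / 2 - f y\<close>:
  minimizing sequences are Cauchy by the parallelogram law, completeness gives a limit, and the
  derivative of \<open>J\<close> vanishes there in every direction.\<close>

lemma riesz_representation:
  fixes f :: "'a::{real_inner,complete_space} \<Rightarrow> real"
  assumes "bounded_linear f"
  shows "\<exists>z. \<forall>y. f y = inner y z"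
proof -
  interpret f: bounded_linear f by fact
  define J where "J y = (norm y)\<^sup>2 / 2 - f y" for y
  obtain K where K: "\<And>y. \<bar>f y\<bar> \<le> norm y * K"
    using f.bounded by (auto simp: real_norm_def)
  have J_lower: "J y \<ge> - (K\<^sup>2 / 2)" for y
  proof -
    have "0 \<le> (norm y - K)\<^sup>2" by simp
    with K[of y] show ?thesis
      unfolding J_def by (simp add: power2_eq_square algebra_simps)
  qed
  define m where "m = Inf (range J)"
  have bdd: "bdd_below (range J)"
    using J_lower by (auto intro!: bdd_belowI)
  have m_le: "m \<le> J y" for y
    unfolding m_def by (rule cInf_lower[OF _ bdd]) simp
  have "\<exists>y. J y < m + 1 / Suc n" for n :: nat
    using cInf_lessD[of "range J" "m + 1 / Suc n"] unfolding m_def by fastforce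
  then obtain X where X: "\<And>n::nat. J (X n) < m + 1 / Suc n" by metis
  \<comment> \<open>Subtracting eight times \<open>J\<close> at the midpoint cancels all terms in
    \<open>f\<close>; the parallelogram law leaves the squared distance.\<close>
  have para: "(norm (y - z))\<^sup>2 \<le> 4 * (J y - m) + 4 * (J z - m)" for y z
  proof -
    have "(norm (y - z))\<^sup>2 = 4 * J y + 4 * J z - 8 * J ((1/2) *\<^sub>R (y + z))"
      unfolding J_def
      by (simp add: power2_norm_eq_inner inner_simps f.add f.scale inner_commute algebra_simps)
    with m_le[of "(1/2) *\<^sub>R (y + z)"] show ?thesis by simp
  qed
  have "Cauchy X"
  proof (rule metric_CauchyI)
    fix e :: real assume "e > 0"
    then obtain N :: nat where N: "8 / e\<^sup>2 < real N"
      using reals_Archimedean2 by blast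
    show "\<exists>M. \<forall>m\<ge>M. \<forall>n\<ge>M. dist (X m) (X n) < e"
    proof (intro exI allI impI)
      fix i j assume ij: "i \<ge> N" "j \<ge> N"
      have "J (X k) - m < e\<^sup>2 / 8" if "k \<ge> N" for k
      proof -
        have "8 / e\<^sup>2 < Suc k" using N that by simp
        then have "1 / Suc k < e\<^sup>2 / 8"
          using \<open>e > 0\<close> by (simp add: field_simps)
        with X[of k] show ?thesis by linarith
      qed
      from this[OF ij(1)] this[OF ij(2)] have "(norm (X i - X j))\<^sup>2 < e\<^sup>2"
        using para[of "X i" "X j"] by (simp add: field_simps)
      then show "dist (X i) (X j) < e"
        using \<open>e > 0\<close> by (simp add: dist_norm power2_less_imp_less)
    qed
  qed
  then obtain z where z: "X \<longlonglongrightarrow> z"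
    using Cauchy_convergent convergent_def by blast
  have "(\<lambda>n. J (X n)) \<longlonglongrightarrow> J z"
    unfolding J_def by (intro tendsto_intros f.tendsto z) simp
  moreover have "(\<lambda>n. m + 1 / Suc n) \<longlonglongrightarrow> m + 0"
    using LIMSEQ_inverse_real_of_nat by (intro tendsto_intros) (simp add: field_simps)
  ultimately have "J z \<le> m + 0"
    by (rule LIMSEQ_le) (use X less_imp_le in blast)
  then have min: "J z \<le> J y" for y using m_le[of y] by simp
  have "f y = inner y z" for y
  proof -
    have D: "((\<lambda>s. J (z + s *\<^sub>R y)) has_real_derivative (inner y z - f y)) (at 0)"
      unfolding J_def power2_norm_eq_inner
      by (simp add: inner_simps f.add f.scale)
        (auto intro!: derivative_eq_intros simp: inner_commute)
    have "inner y z - f y = 0"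
      by (rule DERIV_local_min[OF D zero_less_one]) (use min in simp)
    then show ?thesis by simp
  qed
  then show ?thesis by blast
qed

text \<open>Existence comes from the Riesz representation of the Frechet derivative, where
  completeness enters, and uniqueness from that of the derivative, so the definite description in
  \<open>gradient\<close> is meaningful.\<close>

lemma gradient_works:
  fixes g :: "'a::{real_inner,complete_space} \<Rightarrow> real"
  assumes "g differentiable (at x)"
  shows "GDERIV g x :> gradient g x"
proof -
  obtain f where f: "(g has_derivative f) (at x)"
    using assms unfolding differentiable_def by blast
  then obtain z where "\<forall>y. f y = inner y z"
    using riesz_representation has_derivative_bounded_linear by blast
  then have "f = (\<lambda>y. inner y z)" by auto
  with f have z: "GDERIV g x :> z" unfolding gderiv_def by simp
  show ?thesis
    unfolding gradient_def
  proof (rule theI)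
    show "GDERIV g x :> z" by fact
    fix w assume "GDERIV g x :> w"
    with z have "(\<lambda>h. inner h w) = (\<lambda>h. inner h z)"
      unfolding gderiv_def by (rule has_derivative_unique[rotated])
    then show "w = z" by (metis vector_eq_rdot inner_commute)
  qed
qed

text \<open>On the line through \<open>x\<close> and \<open>y\<close> this is the one-dimensional
  fact that a convex function lies above its tangents.\<close>

lemma convex_gradient_ineq:
  fixes g :: "'a::{real_inner,complete_space} \<Rightarrow> real"
  assumes "convex_on UNIV g" "g differentiable (at x)"
  shows "g x - g y \<le> inner (gradient g x) (x - y)"
proof -
  let ?l = "\<lambda>s. x + s *\<^sub>R (y - x)"
  have "convex_on UNIV (\<lambda>s. g (?l s))"
  proof (rule convex_onI)
    fix t r s :: real assume "0 < t" "t < 1"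
    then have "g ((1 - t) *\<^sub>R ?l r + t *\<^sub>R ?l s) \<le> (1 - t) * g (?l r) + t * g (?l s)"
      by (intro convex_onD[OF assms(1)]) auto
    moreover have "(1 - t) *\<^sub>R ?l r + t *\<^sub>R ?l s = ?l ((1 - t) *\<^sub>R r + t *\<^sub>R s)"
      by (simp add: algebra_simps)
    ultimately show "g (?l ((1 - t) *\<^sub>R r + t *\<^sub>R s)) \<le> (1 - t) * g (?l r) + t * g (?l s)"
      by metis
  qed auto
  moreover have "((\<lambda>s. g (?l s)) has_real_derivative inner (y - x) (gradient g x)) (at 0)"
  proof -
    have "(g has_derivative (\<lambda>h. inner h (gradient g x))) (at (?l 0))"
      using gradient_works[OF assms(2)] by (simp add: gderiv_def)
    moreover have "(?l has_derivative (\<lambda>s. s *\<^sub>R (y - x))) (at 0)"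
      by (auto intro!: derivative_eq_intros)
    ultimately have "((\<lambda>s. g (?l s)) has_derivative (\<lambda>s. inner (s *\<^sub>R (y - x)) (gradient g x))) (at 0)"
      by (rule has_derivative_compose[rotated])
    then show ?thesis
      unfolding has_field_derivative_def by (simp add: mult_commute_abs)
  qed
  ultimately have "g (?l 1) - g (?l 0) \<ge> inner (y - x) (gradient g x) * (1 - 0)"
    by (intro convex_on_imp_above_tangent[where A = UNIV]) auto
  then show ?thesis by (simp add: inner_simps inner_commute)
qed

subsection \<open>Absolute continuity\<close>

lemma abs_continuous_on_subset:
  "abs_continuous_on c d f \<Longrightarrow> {c'..d'} \<subseteq> {c..d} \<Longrightarrow> abs_continuous_on c' d' f"
  unfolding abs_continuous_on_def by (meson order_trans)

lemma abs_continuous_on_imp_continuous_on: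
  assumes "abs_continuous_on c d f"
  shows "continuous_on {c..d} f"
  unfolding continuous_on_iff
proof (intro ballI allI impI)
  fix s e :: real assume s: "s \<in> {c..d}" and e: "e > 0"
  obtain \<eta> where \<eta>: "\<eta> > 0" "\<And>D S. D division_of S \<Longrightarrow> S \<subseteq> {c..d} \<Longrightarrow>
      (\<Sum>k\<in>D. Sup k - Inf k) < \<eta> \<Longrightarrow> (\<Sum>k\<in>D. norm (f (Sup k) - f (Inf k))) < e"
    using assms e unfolding abs_continuous_on_def by metis
  \<comment> \<open>A single interval is a division of itself, so the condition on divisions
    specializes to uniform continuity.\<close>
  have step: "norm (f v - f u) < e" if "u \<le> v" "v - u < \<eta>" "u \<in> {c..d}" "v \<in> {c..d}" for u v
    using \<eta>(2)[of "{{u..v}}" "{u..v}"] that division_of_self[of u v]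
    by (auto simp: box_real)
  show "\<exists>d'>0. \<forall>s'\<in>{c..d}. dist s' s < d' \<longrightarrow> dist (f s') (f s) < e"
  proof (intro exI[of _ \<eta>] conjI ballI impI \<eta>(1))
    fix s' assume "s' \<in> {c..d}" "dist s' s < \<eta>"
    then show "dist (f s') (f s) < e"
      using step[of s s'] step[of s' s] s
      by (cases "s \<le> s'") (auto simp: dist_norm norm_minus_commute)
  qed
qed

section \<open>Increments over tagged divisions and derivatives known almost everywhere\<close>

text \<open>Two tags of a tagged partial division can share an interval only if it has empty
  interior, hence is a single point with zero increment, so dropping the tags changes
  nothing.\<close>

lemma sum_increments_tagged_eq:
  fixes f :: "real \<Rightarrow> 'a::real_normed_vector"
  assumes "D tagged_partial_division_of {c..d}"
  shows "(\<Sum>(t,K)\<in>D. norm (f (Sup K) - f (Inf K))) = (\<Sum>K\<in>snd ` D. norm (f (Sup K) - f (Inf K)))"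
proof -
  \<comment> \<open>The summation lemma wants 0 on every box with empty interior, including the
    empty one, where \<open>Sup\<close> and \<open>Inf\<close> are unspecified.\<close>
  let ?n = "\<lambda>K. if K = {} then 0 else norm (f (Sup K) - f (Inf K))"
  have D: "D tagged_division_of \<Union>(snd ` D)"
    using assms by (rule tagged_partial_division_of_Union_self)
  have ne: "K \<noteq> {}" if "(t, K) \<in> D" for t K
    using tagged_division_ofD(2)[OF D that] by auto
  have "(\<Sum>(t,K)\<in>D. ?n K) = (\<Sum>K\<in>snd ` D. ?n K)"
    by (rule sum.over_tagged_division_lemma[OF D]) (auto simp: box_real)
  moreover have "(\<Sum>(t,K)\<in>D. ?n K) = (\<Sum>(t,K)\<in>D. norm (f (Sup K) - f (Inf K)))"
    by (rule sum.cong) (use ne in auto)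
  moreover have "(\<Sum>K\<in>snd ` D. ?n K) = (\<Sum>K\<in>snd ` D. norm (f (Sup K) - f (Inf K)))"
    by (rule sum.cong) (use ne in auto)
  ultimately show ?thesis by simp
qed

text \<open>Cousin's lemma: both the absolute continuity of \<open>A\<close> and the pointwise derivative bounds of \<open>B\<close>
  make the increments over intervals tagged in the null set negligible, because
  functions supported on a null set have Henstock--Kurzweil integral zero.\<close>

lemma mean_value_inequality_ae:
  fixes A B :: "real \<Rightarrow> 'a::real_normed_vector"
  assumes "c \<le> d" "M \<ge> 0" and A: "abs_continuous_on c d A"
    and B: "\<And>t. t \<in> {c..d} \<Longrightarrow> (B has_vector_derivative B' t) (at t within {c..d})"
    and N: "negligible N"
    and F': "\<And>t. t \<in> {c..d} - N \<Longrightarrow>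
      ((\<lambda>t. A t + B t) has_vector_derivative F' t) (at t within {c..d})"
    and M: "\<And>t. t \<in> {c..d} - N \<Longrightarrow> norm (F' t) \<le> M"
  shows "norm (A d + B d - (A c + B c)) \<le> M * (d - c)"
proof -
  define F where "F t = A t + B t" for t
  \<comment> \<open>\<open>M + e\<close> bounds the slopes at tags outside \<open>N\<close>; at tags
    in \<open>N\<close> the increments of \<open>A\<close> and of \<open>B\<close> cost one
    \<open>e\<close> each.\<close>
  have bound: "norm (F d - F c) \<le> (M + e) * (d - c) + e + e" if e: "e > 0" for e
  proof -
    \<comment> \<open>Riemann sums of \<open>\<phi>\<close> measure the total length of the
      intervals tagged in \<open>N\<close>, those of \<open>\<psi>\<close> dominate the increments
      of \<open>B\<close> there. Both functions vanish off the null set \<open>N\<close>, so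
      suitable gauges make these sums small.\<close>
    define \<phi> where "\<phi> t = (if t \<in> N then 1 else 0 :: real)" for t
    define \<psi> where "\<psi> t = (if t \<in> N then norm (B' t) + 1 else 0)" for t
    obtain \<eta> where \<eta>: "\<eta> > 0" "\<And>D S. D division_of S \<Longrightarrow> S \<subseteq> {c..d} \<Longrightarrow>
      (\<Sum>k\<in>D. Sup k - Inf k) < \<eta> \<Longrightarrow> (\<Sum>k\<in>D. norm (A (Sup k) - A (Inf k))) < e"
      using A e unfolding abs_continuous_on_def by metis
    have "(\<phi> has_integral 0) {c..d}" "(\<psi> has_integral 0) {c..d}"
      by (rule has_integral_negligible[OF N]; simp add: \<phi>_def \<psi>_def)+
    with \<eta>(1) e obtain \<gamma>1 \<gamma>2 where \<gamma>1: "gauge \<gamma>1"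
        "\<And>D. D tagged_division_of {c..d} \<Longrightarrow> \<gamma>1 fine D \<Longrightarrow>
           norm ((\<Sum>(t,K)\<in>D. measure lborel K *\<^sub>R \<phi> t) - 0) < \<eta>"
      and \<gamma>2: "gauge \<gamma>2"
        "\<And>D. D tagged_division_of {c..d} \<Longrightarrow> \<gamma>2 fine D \<Longrightarrow>
           norm ((\<Sum>(t,K)\<in>D. measure lborel K *\<^sub>R \<psi> t) - 0) < e"
      unfolding has_integral_real by meson
    \<comment> \<open>At tags in \<open>N\<close> only \<open>B\<close> is known to have a
      derivative, so \<open>H\<close> switches between \<open>B\<close> and \<open>F\<close>, and
      \<open>b\<close> is the matching local Lipschitz constant.\<close>
    define b where "b t = (if t \<in> N then norm (B' t) + 1 else M + e)" for t
    define H where "H t = (if t \<in> N then B else F)" for t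
    have "\<exists>r>0. \<forall>s\<in>{c..d}. norm (s - t) < r \<longrightarrow> norm (H t s - H t t) \<le> b t * norm (s - t)"
      if t: "t \<in> {c..d}" for t
    proof (cases "t \<in> N")
      case True
      obtain r where r: "r > 0" "\<And>s. s \<in> {c..d} \<Longrightarrow> norm (s - t) < r \<Longrightarrow>
          norm (B s - B t - (s - t) *\<^sub>R B' t) \<le> 1 * norm (s - t)"
        using B[OF t] unfolding has_vector_derivative_def has_derivative_within_alt
        by (metis zero_less_one)
      have "norm (B s - B t) \<le> (norm (B' t) + 1) * norm (s - t)"
        if "s \<in> {c..d}" "norm (s - t) < r" for s
        using r(2)[OF that] norm_triangle_sub[of "B s - B t" "(s - t) *\<^sub>R B' t"]
        unfolding distrib_right norm_scaleR real_norm_def mult.commute[of "norm (B' t)"] by linarith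
      with True r(1) show ?thesis by (auto simp: H_def b_def)
    next
      case False
      obtain r where r: "r > 0" "\<And>s. s \<in> {c..d} \<Longrightarrow> norm (s - t) < r \<Longrightarrow>
          norm (F s - F t - (s - t) *\<^sub>R F' t) \<le> e * norm (s - t)"
        using F'[of t] t e False
        unfolding has_vector_derivative_def has_derivative_within_alt F_def
        by (metis DiffI)
      have "norm (F s - F t) \<le> (M + e) * norm (s - t)"
        if "s \<in> {c..d}" "norm (s - t) < r" for s
      proof -
        have "norm (s - t) * norm (F' t) \<le> norm (s - t) * M"
          using M[of t] t False by (intro mult_left_mono) auto
        then show ?thesis
          using r(2)[OF that] norm_triangle_sub[of "F s - F t" "(s - t) *\<^sub>R F' t"]
          unfolding distrib_right norm_scaleR real_norm_def mult.commute[of M] by linarith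
      qed
      with r(1) have "\<exists>r>0. \<forall>s\<in>{c..d}. norm (s - t) < r \<longrightarrow>
          norm (F s - F t) \<le> (M + e) * norm (s - t)" by blast
      with False show ?thesis by (auto simp: H_def b_def)
    qed
    then obtain \<rho> where \<rho>: "\<And>t. t \<in> {c..d} \<Longrightarrow> \<rho> t > 0"
      "\<And>t s. t \<in> {c..d} \<Longrightarrow> s \<in> {c..d} \<Longrightarrow> norm (s - t) < \<rho> t \<Longrightarrow>
         norm (H t s - H t t) \<le> b t * norm (s - t)"
      by metis
    define \<gamma>3 where "\<gamma>3 t = ball t (if t \<in> {c..d} then \<rho> t else 1)" for t
    have "gauge \<gamma>3"
      unfolding gauge_def \<gamma>3_def using \<rho>(1) by auto
    then have "gauge (\<lambda>t. (\<gamma>1 t \<inter> \<gamma>2 t) \<inter> \<gamma>3 t)"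
      by (intro gauge_Int \<gamma>1(1) \<gamma>2(1))
    then obtain D where D: "D tagged_division_of {c..d}"
        and "(\<lambda>t. (\<gamma>1 t \<inter> \<gamma>2 t) \<inter> \<gamma>3 t) fine D"
      by (rule fine_division_exists_real)
    then have fine: "\<gamma>1 fine D" "\<gamma>2 fine D" "\<gamma>3 fine D"
      unfolding fine_Int by auto
    have finD: "finite D" using D by auto
    have tag: "\<exists>u v. K = {u..v} \<and> u \<le> t \<and> t \<le> v \<and> c \<le> u \<and> v \<le> d \<and> t \<in> {c..d}"
      if tK: "(t,K) \<in> D" for t K
    proof -
      obtain u v where "K = {u..v}" "t \<in> K" "K \<subseteq> {c..d}"
        using tagged_division_ofD(2-4)[OF D tK] by (metis box_real(2))
      then show ?thesis by auto
    qed
    \<comment> \<open>The tag lies between the endpoints, so its distances to them add up to the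
      length of \<open>K\<close>.\<close>
    have straddle: "norm (H t (Sup K) - H t (Inf K)) \<le> b t * measure lborel K" if tK: "(t,K) \<in> D" for t K
    proof -
      obtain u v where uv: "K = {u..v}" "u \<le> t" "t \<le> v" "c \<le> u" "v \<le> d" "t \<in> {c..d}"
        using tag[OF tK] by blast
      have "K \<subseteq> ball t (\<rho> t)"
        using fine(3) tK uv(6) unfolding fine_def \<gamma>3_def by fastforce
      moreover have "u \<in> K" "v \<in> K" using uv by auto
      ultimately have "norm (u - t) < \<rho> t" "norm (v - t) < \<rho> t"
        by (auto simp: dist_norm norm_minus_commute subset_iff simp del: real_norm_def)
      then have "norm (H t u - H t t) \<le> b t * norm (u - t)" "norm (H t v - H t t) \<le> b t * norm (v - t)"
        using \<rho>(2)[of t u] \<rho>(2)[of t v] uv by auto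
      moreover have "norm (H t v - H t u) \<le> norm (H t v - H t t) + norm (H t u - H t t)"
        by (metis norm_triangle_ineq4 diff_diff_eq2 diff_add_cancel)
      ultimately have "norm (H t v - H t u) \<le> b t * (v - t) + b t * (t - u)"
        using uv by simp
      with uv show ?thesis by (simp add: algebra_simps)
    qed
    define D1 where "D1 = {(t,K) \<in> D. t \<notin> N}"
    define D2 where "D2 = {(t,K) \<in> D. t \<in> N}"
    have D12: "D = D1 \<union> D2" "D1 \<inter> D2 = {}" "finite D1" "finite D2"
      using finD unfolding D1_def D2_def by (auto intro: rev_finite_subset)
    have "D2 tagged_partial_division_of {c..d}"
      using D D12(1) tagged_partial_division_subset tagged_division_of_def by (metis Un_upper2)
    note D2 = this partial_division_of_tagged_division[OF this] sum_increments_tagged_eq[OF this]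
    have "F d - F c = (\<Sum>(t,K)\<in>D. F (Sup K) - F (Inf K))"
      using additive_tagged_division_1[OF assms(1) D, of F] by simp
    also have "norm \<dots> \<le> (\<Sum>(t,K)\<in>D. norm (F (Sup K) - F (Inf K)))"
      by (rule order_trans[OF norm_sum]) (simp add: case_prod_unfold)
    also have "\<dots> = (\<Sum>(t,K)\<in>D1. norm (F (Sup K) - F (Inf K))) + (\<Sum>(t,K)\<in>D2. norm (F (Sup K) - F (Inf K)))"
      using D12 by (simp add: sum.union_disjoint)
    also have "(\<Sum>(t,K)\<in>D1. norm (F (Sup K) - F (Inf K))) \<le> (\<Sum>(t,K)\<in>D1. (M + e) * measure lborel K)"
      using straddle by (intro sum_mono) (force simp: D1_def H_def b_def)
    also have "\<dots> \<le> (\<Sum>(t,K)\<in>D. (M + e) * measure lborel K)"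
      using e \<open>M \<ge> 0\<close> finD D12 by (intro sum_mono2) (auto simp: case_prod_unfold)
    also have "\<dots> = (M + e) * (\<Sum>(t,K)\<in>D. measure lborel K)"
      by (simp add: sum_distrib_left case_prod_unfold)
    also have "(\<Sum>(t,K)\<in>D. measure lborel K) = d - c"
      using additive_content_tagged_division[of D c d] D assms(1) by (simp add: box_real)
    also have "(\<Sum>(t,K)\<in>D2. norm (F (Sup K) - F (Inf K))) \<le>
        (\<Sum>(t,K)\<in>D2. norm (A (Sup K) - A (Inf K)) + measure lborel K *\<^sub>R \<psi> t)"
    proof (rule sum_mono, clarify)
      fix t K assume tK: "(t,K) \<in> D2"
      then have "norm (B (Sup K) - B (Inf K)) \<le> measure lborel K *\<^sub>R \<psi> t"
        using straddle[of t K] by (auto simp: D2_def H_def b_def \<psi>_def mult.commute)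
      moreover have "norm (F (Sup K) - F (Inf K))
          \<le> norm (A (Sup K) - A (Inf K)) + norm (B (Sup K) - B (Inf K))"
        unfolding F_def by (metis add_diff_add norm_triangle_ineq)
      ultimately show "norm (F (Sup K) - F (Inf K)) \<le> norm (A (Sup K) - A (Inf K)) + measure lborel K *\<^sub>R \<psi> t"
        by linarith
    qed
    also have "\<dots> = (\<Sum>(t,K)\<in>D2. norm (A (Sup K) - A (Inf K))) + (\<Sum>(t,K)\<in>D2. measure lborel K *\<^sub>R \<psi> t)"
      by (simp add: case_prod_unfold sum.distrib)
    also have "(\<Sum>(t,K)\<in>D2. measure lborel K *\<^sub>R \<psi> t) \<le> (\<Sum>(t,K)\<in>D. measure lborel K *\<^sub>R \<psi> t)"
      using finD D12 by (intro sum_mono2) (auto simp: \<psi>_def case_prod_unfold)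
    also have "\<dots> \<le> e"
      using \<gamma>2(2)[OF D fine(2)] by simp
    \<comment> \<open>\<open>\<gamma>1\<close> keeps the total length of the intervals in
      \<open>D2\<close> below \<open>\<eta>\<close>, so absolute continuity of \<open>A\<close>
      applies to them as one family.\<close>
    also have "(\<Sum>(t,K)\<in>D2. norm (A (Sup K) - A (Inf K))) \<le> e"
    proof -
      have "(\<Sum>K\<in>snd ` D2. Sup K - Inf K) = (\<Sum>K\<in>snd ` D2. norm (id (Sup K) - id (Inf K)))"
        using tag D12(1) by (intro sum.cong) fastforce+
      also have "\<dots> = (\<Sum>(t,K)\<in>D2. norm (id (Sup K) - id (Inf K)))"
        using sum_increments_tagged_eq[OF D2(1), of id] by simp
      also have "\<dots> = (\<Sum>(t,K)\<in>D2. measure lborel K *\<^sub>R \<phi> t)"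
        using tag by (intro sum.cong) (fastforce simp: D2_def \<phi>_def)+
      also have "\<dots> \<le> (\<Sum>(t,K)\<in>D. measure lborel K *\<^sub>R \<phi> t)"
        using finD D12 by (intro sum_mono2) (auto simp: \<phi>_def case_prod_unfold)
      also have "\<dots> < \<eta>"
        using \<gamma>1(2)[OF D fine(1)] by simp
      finally have "(\<Sum>K\<in>snd ` D2. norm (A (Sup K) - A (Inf K))) < e"
        using tag D12(1) by (intro \<eta>(2)[OF D2(2)]) (fastforce)+
      then show ?thesis using D2(3)[of A] by simp
    qed
    finally show ?thesis by simp
  qed
  have "norm (F d - F c) \<le> M * (d - c)"
  proof (rule field_le_epsilon)
    fix e :: real assume "e > 0"
    have pos: "d - c + 2 > 0" using assms(1) by simp
    define e' where "e' = e / (d - c + 2)"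
    have "e' > 0" using \<open>e > 0\<close> pos unfolding e'_def by simp
    from bound[OF this] have "norm (F d - F c) \<le> M * (d - c) + e' * (d - c + 2)"
      by (simp add: algebra_simps)
    then show "norm (F d - F c) \<le> M * (d - c) + e" using pos by (simp add: e'_def)
  qed
  then show ?thesis by (simp add: F_def)
qed

text \<open>The integral of \<open>G\<close> is avoided: the type \<open>'a\<close> need not belong to class \<open>banach\<close>.\<close>

lemma has_vector_derivative_if_ae:
  fixes A B :: "real \<Rightarrow> 'a::real_normed_vector"
  assumes A: "abs_continuous_on c d A"
    and B: "\<And>t. t \<in> {c..d} \<Longrightarrow> (B has_vector_derivative B' t) (at t)"
    and N: "negligible N"
    and G: "continuous_on {c..d} G"
    and ae: "\<And>t. t \<in> {c..d} - N \<Longrightarrow> ((\<lambda>t. A t + B t) has_vector_derivative G t) (at t)"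
    and t: "c < t" "t < d"
  shows "((\<lambda>t. A t + B t) has_vector_derivative G t) (at t)"
  unfolding has_vector_derivative_def has_derivative_within_alt
proof (intro conjI allI impI bounded_linear_scaleR_left)
  fix e :: real assume "e > 0"
  then obtain r where r: "r > 0" "\<And>s. s \<in> {c..d} \<Longrightarrow> dist s t < r \<Longrightarrow> dist (G s) (G t) < e"
    using G[unfolded continuous_on_iff, rule_format, of t e] t by auto
  have lin: "((\<lambda>s. s *\<^sub>R G t) has_vector_derivative G t) (at s)" for s
    unfolding has_vector_derivative_def
    by (rule bounded_linear_imp_has_derivative[OF bounded_linear_scaleR_left])
  \<comment> \<open>Subtracting the linear function with slope \<open>G t\<close> leaves the almost
    everywhere derivative \<open>G s - G t\<close>, which continuity makes smaller than
    \<open>e\<close> near \<open>t\<close>; the mean value inequality then bounds the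
    increment.\<close>
  have incr: "norm (A v + B v - (A w + B w) - (v - w) *\<^sub>R G t) \<le> e * (v - w)"
    if "w \<le> v" "{w..v} \<subseteq> {c..d}" "\<And>s. s \<in> {w..v} \<Longrightarrow> dist s t < r" for v w
  proof -
    have "norm (A v + (B v - v *\<^sub>R G t) - (A w + (B w - w *\<^sub>R G t))) \<le> e * (v - w)"
    proof (rule mean_value_inequality_ae[where B = "\<lambda>s. B s - s *\<^sub>R G t" and N = N
          and B' = "\<lambda>s. B' s - G t" and F' = "\<lambda>s. G s - G t"])
      fix s assume s: "s \<in> {w..v}"
      show "((\<lambda>s. B s - s *\<^sub>R G t) has_vector_derivative (B' s - G t)) (at s within {w..v})"
        using s that(2) by (intro has_vector_derivative_at_within[OF has_vector_derivative_diff] B lin) auto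
    next
      fix s assume s: "s \<in> {w..v} - N"
      have "((\<lambda>s. (A s + B s) - s *\<^sub>R G t) has_vector_derivative (G s - G t)) (at s within {w..v})"
        using s that(2) by (intro has_vector_derivative_at_within[OF has_vector_derivative_diff] ae lin) auto
      then show "((\<lambda>s. A s + (B s - s *\<^sub>R G t)) has_vector_derivative (G s - G t)) (at s within {w..v})"
        by (simp add: add_diff_eq)
      show "norm (G s - G t) \<le> e"
      proof -
        have "dist (G s) (G t) < e"
          using s that(2) by (intro r(2) that(3)) auto
        then show ?thesis by (simp add: dist_norm)
      qed
    qed (fact that(1), use \<open>e > 0\<close> in simp, rule abs_continuous_on_subset[OF A that(2)], rule N)
    then show ?thesis by (simp add: algebra_simps)
  qed
  show "\<exists>r>0. \<forall>s\<in>UNIV. norm (s - t) < r \<longrightarrow>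
      norm (A s + B s - (A t + B t) - (s - t) *\<^sub>R G t) \<le> e * norm (s - t)"
  proof (intro exI[of _ "min r (min (t - c) (d - t))"] conjI ballI impI)
    fix s assume s: "norm (s - t) < min r (min (t - c) (d - t))"
    show "norm (A s + B s - (A t + B t) - (s - t) *\<^sub>R G t) \<le> e * norm (s - t)"
    proof (cases "t \<le> s")
      case True
      then show ?thesis using incr[of t s] s by (auto simp: dist_real_def)
    next
      case False
      have "norm (A s + B s - (A t + B t) - (s - t) *\<^sub>R G t)
          = norm (A t + B t - (A s + B s) - (t - s) *\<^sub>R G t)"
        by (subst norm_minus_cancel[symmetric]) (simp add: algebra_simps)
      then show ?thesis using incr[of s t] s False by (auto simp: dist_real_def)
    qed
  qed (use r t in auto)
qed

section \<open>The first-order form of (DS) at every time after \<open>t0\<close>\<close>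

text \<open>By the chain rule the Hessian term is the derivative of
  \<open>\<beta> *\<^sub>R gradient g (x t)\<close>. This is the everywhere differentiable summand
  in \<open>has_vector_derivative_if_ae\<close>, and \<open>dot t0 x\<close> the absolutely
  continuous one.\<close>

lemma
  assumes g: "twice_differentiable g"
    and \<delta>: "\<delta> differentiable_on {t0..}"
    and t0: "t0 > 0"
    and sol: "global_solution g \<delta> \<alpha> \<beta> a p q t0 x0 v0 x"
    and t: "t > t0"
  shows solution_has_derivative: "(x has_vector_derivative dot t0 x t) (at t)"
    and solution_classical: "((\<lambda>t. dot t0 x t + \<beta> *\<^sub>R gradient g (x t)) has_vector_derivative
      - ((\<alpha> / t powr q) *\<^sub>R dot t0 x t) - \<delta> t *\<^sub>R gradient g (x t) - (a / t powr p) *\<^sub>R x t) (at t)"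
proof -
  let ?v = "dot t0 x" and ?G = "\<lambda>t. gradient g (x t)"
  define R where "R t = - ((\<alpha> / t powr q) *\<^sub>R ?v t) - \<delta> t *\<^sub>R ?G t - (a / t powr p) *\<^sub>R x t" for t
  have at: "at s within {t0..} = at s" if "s > t0" for s
    using that by (intro at_within_interior) (auto simp: interior_real_atLeast)
  have dot: "(f has_vector_derivative dot t0 f s) (at s)"
    if "f differentiable (at s within {t0..})" "s > t0" for f :: "real \<Rightarrow> 'a" and s
    using that vector_derivative_works[of f "at s"] unfolding dot_def by (simp add: at)
  have x': "(x has_vector_derivative ?v s) (at s)" if "s > t0" for s
    using sol that dot[of x s] unfolding global_solution_def by auto
  then show "(x has_vector_derivative dot t0 x t) (at t)" using t by blast
  have G': "(?G has_vector_derivative hessian g (x s) (?v s)) (at s)" if "s > t0" for s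
  proof -
    have "(gradient g has_derivative hessian g (x s)) (at (x s))"
      using g frechet_derivative_works unfolding twice_differentiable_def hessian_def by blast
    from has_derivative_compose[OF x'[OF that, unfolded has_vector_derivative_def] this]
    show ?thesis
      unfolding has_vector_derivative_def
      using linear_scale[OF has_derivative_linear[OF
        \<open>(gradient g has_derivative hessian g (x s)) (at (x s))\<close>]] by simp
  qed
  define N where "N = {s. \<not> (s \<ge> t0 \<longrightarrow> ?v differentiable (at s within {t0..}) \<and>
        dot t0 ?v s + (\<alpha> / s powr q) *\<^sub>R ?v s
          + \<beta> *\<^sub>R hessian g (x s) (?v s) + \<delta> s *\<^sub>R ?G s
          + (a / s powr p) *\<^sub>R x s = 0)}"
  have N: "negligible N"
    using sol unfolding global_solution_def N_def eventually_ae_filter_negligible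
    by (meson negligible_subset)
  \<comment> \<open>On a compact interval strictly to the right of \<open>t0\<close> all derivatives
    are two-sided.\<close>
  obtain c d where cd: "t0 < c" "c < t" "t < d" using t dense gt_ex by metis
  have sub: "{c..d} \<subseteq> {t0..d}" using cd by auto
  have ac: "abs_continuous_on c d ?v"
    using sol cd sub unfolding global_solution_def locally_abs_continuous_from_def
    by (meson abs_continuous_on_subset less_trans less_imp_le)
  have cont: "continuous_on {c..d} R"
    unfolding R_def
  proof (intro continuous_intros)
    show "continuous_on {c..d} ?v" using ac by (rule abs_continuous_on_imp_continuous_on)
    show "continuous_on {c..d} \<delta>"
      using differentiable_imp_continuous_on[OF \<delta>] by (rule continuous_on_subset) (use cd in auto)
    show "continuous_on {c..d} ?G"
      using has_vector_derivative_continuous[OF G'] cd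
      by (intro continuous_at_imp_continuous_on) auto
    show "continuous_on {c..d} x"
      using has_vector_derivative_continuous[OF x'] cd
      by (intro continuous_at_imp_continuous_on) auto
  qed (use cd t0 in auto)
  have "((\<lambda>t. ?v t + \<beta> *\<^sub>R ?G t) has_vector_derivative R t) (at t)"
  proof (rule has_vector_derivative_if_ae[OF ac _ N cont _ cd(2,3),
      where B' = "\<lambda>s. \<beta> *\<^sub>R hessian g (x s) (?v s)"])
    fix s assume "s \<in> {c..d}"
    then show "((\<lambda>t. \<beta> *\<^sub>R ?G t) has_vector_derivative \<beta> *\<^sub>R hessian g (x s) (?v s)) (at s)"
      using bounded_linear.has_vector_derivative[OF bounded_linear_scaleR_right G'[of s]] cd by auto
  next
    fix s assume s: "s \<in> {c..d} - N"
    then have "?v differentiable (at s within {t0..})" and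
      eq: "dot t0 ?v s + (\<alpha> / s powr q) *\<^sub>R ?v s
          + \<beta> *\<^sub>R hessian g (x s) (?v s) + \<delta> s *\<^sub>R ?G s + (a / s powr p) *\<^sub>R x s = 0"
      using cd unfolding N_def by auto
    then have "(?v has_vector_derivative dot t0 ?v s) (at s)"
      using dot s cd by auto
    moreover have "((\<lambda>t. \<beta> *\<^sub>R ?G t) has_vector_derivative \<beta> *\<^sub>R hessian g (x s) (?v s)) (at s)"
      using bounded_linear.has_vector_derivative[OF bounded_linear_scaleR_right G'[of s]] s cd by auto
    ultimately have "((\<lambda>t. ?v t + \<beta> *\<^sub>R ?G t) has_vector_derivative
        dot t0 ?v s + \<beta> *\<^sub>R hessian g (x s) (?v s)) (at s)"
      by (rule has_vector_derivative_add)
    moreover have "dot t0 ?v s + \<beta> *\<^sub>R hessian g (x s) (?v s) - R s = 0"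
      using eq unfolding R_def by (simp add: algebra_simps)
    ultimately show "((\<lambda>t. ?v t + \<beta> *\<^sub>R ?G t) has_vector_derivative R s) (at s)"
      by simp
  qed
  then show "((\<lambda>t. dot t0 x t + \<beta> *\<^sub>R gradient g (x t)) has_vector_derivative
      - ((\<alpha> / t powr q) *\<^sub>R dot t0 x t) - \<delta> t *\<^sub>R gradient g (x t) - (a / t powr p) *\<^sub>R x t) (at t)"
    unfolding R_def .
qed

subsection \<open>Energy estimates\<close>

text \<open>Cauchy-Schwarz followed by completion of a square. The condition on \<open>k\<close>
  says that the quadratic form \<open>A |y|^2 - k <y,z> + B |z|^2\<close> has nonpositive
  discriminant.\<close>

lemma inner_young:
  fixes y z :: "'a::real_inner"
  assumes "A \<ge> 0" "B \<ge> 0" "k\<^sup>2 \<le> 4 * A * B"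
  shows "k * inner y z \<le> A * inner y y + B * inner z z"
proof -
  have "\<bar>k\<bar> \<le> sqrt (4 * A * B)"
    using assms(3) by (metis real_sqrt_abs real_sqrt_le_mono)
  also have "\<dots> = 2 * (sqrt A * sqrt B)"
    by (simp add: real_sqrt_mult)
  finally have k: "\<bar>k\<bar> \<le> 2 * (sqrt A * sqrt B)" .
  have "k * inner y z \<le> \<bar>k\<bar> * (norm y * norm z)"
    by (metis Cauchy_Schwarz_ineq2 abs_ge_self abs_ge_zero abs_mult mult_left_mono order_trans)
  also have "\<dots> \<le> 2 * (sqrt A * sqrt B) * (norm y * norm z)"
    using k by (intro mult_right_mono) auto
  also have "\<dots> = (sqrt A * norm y)\<^sup>2 + (sqrt B * norm z)\<^sup>2 - (sqrt A * norm y - sqrt B * norm z)\<^sup>2"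
    by (simp add: power2_eq_square algebra_simps)
  also have "\<dots> \<le> (sqrt A * norm y)\<^sup>2 + (sqrt B * norm z)\<^sup>2" by simp
  also have "\<dots> = A * inner y y + B * inner z z"
    using assms by (simp add: power_mult_distrib power2_norm_eq_inner)
  finally show ?thesis .
qed

lemma inner_diff_self_le:
  fixes y z :: "'a::real_inner"
  shows "inner (y - z) (y - z) \<le> 2 * inner y y + 2 * inner z z"
  using inner_ge_zero[of "y + z"] by (simp add: inner_simps inner_commute)

text \<open>The second factor of the inner product collapses to
  \<open>b' h - m v - (R \<delta> - \<beta> R') G - a \<pi> R x\<close>. Pairing it with
  \<open>b h + R u\<close> produces the negatives of the terms in \<open>inner h v\<close>,
  \<open>inner x v\<close> and \<open>inner G v\<close> on the left, which explains the choice of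
  \<open>m\<close> and \<open>c\<close>.\<close>

lemma energy_derivative_identity:
  fixes x h v G :: "'a::real_inner" and R R' \<delta> \<alpha> \<beta> \<tau> \<pi> a b b' :: real
  defines "u \<equiv> v + \<beta> *\<^sub>R G"
  defines "m \<equiv> \<alpha> * \<tau> * R - R' - b" and "c \<equiv> R\<^sup>2 * \<delta> - \<beta> * R * R'"
  defines "u' \<equiv> - ((\<alpha> * \<tau>) *\<^sub>R v) - \<delta> *\<^sub>R G - (a * \<pi>) *\<^sub>R x"
  shows "c * inner G v
      + inner (b *\<^sub>R h + R *\<^sub>R u) (b' *\<^sub>R h + b *\<^sub>R v + R' *\<^sub>R u + R *\<^sub>R u')
      + a * (R\<^sup>2 * \<pi>) * inner x v + m * b * inner h v
    = - (c * \<beta>) * inner G G + b * b' * inner h h - b * (R * \<delta> - \<beta> * R') * inner G h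
      - a * \<pi> * R * b * inner x h + b' * inner h (R *\<^sub>R u) - R * m * inner u v
      - a * \<beta> * (R\<^sup>2 * \<pi>) * inner x G"
  unfolding assms by (simp add: inner_simps inner_commute power2_eq_square algebra_simps)

text \<open>Convexity turns \<open>inner G h\<close> into decay of \<open>c * f\<close>, the
  regularization term gives decay of \<open>inner x x\<close> and \<open>inner h h\<close> at the
  price of \<open>inner xs xs\<close>, and friction gives decay of \<open>R u\<close>. The term
  \<open>- (c * \<beta>) * inner G G\<close>, supplied by the Hessian damping, absorbs the
  remainders of 5 and 6, a quarter of it each.\<close>

lemma energy_dissipation:
  fixes x xs v G :: "'a::real_inner" and R R' \<delta> \<alpha> \<beta> \<tau> \<pi> a b b' :: real
  defines "u \<equiv> v + \<beta> *\<^sub>R G" and "h \<equiv> x - xs" and "\<omega> \<equiv> R\<^sup>2 * \<pi>"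
  defines "c \<equiv> R\<^sup>2 * \<delta> - \<beta> * R * R'"
  assumes pos: "R > 0" "\<alpha> > 0" "\<beta> > 0" "a > 0" "\<tau> > 0" "\<omega> > 0" "c > 0"
    and f: "0 \<le> f" "f \<le> inner G h"
    and b: "b = \<alpha> / 2 * R * \<tau>" "b' \<le> 0" "b'\<^sup>2 \<le> a * \<alpha>\<^sup>2 / 256 * \<omega> * \<tau>\<^sup>2"
    and m: "\<alpha> / 4 * R * \<tau> \<le> m" "\<beta> * R * m \<le> c / 2"
    and c': "c' \<le> \<alpha> / 4 * c * \<tau>"
    and \<omega>: "\<omega>' \<le> 0" "16 * a * \<beta> * \<omega> \<le> \<alpha> * \<tau> * c"
    and \<xi>: "\<xi>' \<le> a * \<alpha> / 2 * (\<omega> * \<tau>)"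
  shows "c' * f
      + (- (c * \<beta>) * inner G G + b * b' * inner h h - b * (R * \<delta> - \<beta> * R') * inner G h
        - a * \<pi> * R * b * inner x h + b' * inner h (R *\<^sub>R u) - R * m * inner u v
        - a * \<beta> * \<omega> * inner x G)
      + a / 2 * \<omega>' * inner x x + \<xi>' / 2 * inner h h
    \<le> - (\<alpha> / 4 * \<tau> * c * f) - \<alpha> / 16 * \<tau> * inner (R *\<^sub>R u) (R *\<^sub>R u)
      - a * \<alpha> / 8 * (\<omega> * \<tau>) * inner x x + a * \<alpha> * (\<omega> * \<tau>) * inner xs xs"
proof -
  have wt: "\<omega> * \<tau> > 0" using pos by simp
  \<comment> \<open>Of the rate \<open>\<alpha> / 2\<close> supplied by convexity, half pays for the
    growth of the weight \<open>c\<close> and half remains.\<close>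
  have 1: "c' * f - b * (R * \<delta> - \<beta> * R') * inner G h \<le> - (\<alpha> / 4 * \<tau> * c * f)"
  proof -
    have "b * (R * \<delta> - \<beta> * R') * inner G h = \<alpha> / 2 * \<tau> * c * inner G h"
      unfolding b(1) c_def by (simp add: power2_eq_square field_simps)
    moreover have "\<alpha> / 2 * \<tau> * c * f \<le> \<alpha> / 2 * \<tau> * c * inner G h"
      using f pos by (intro mult_left_mono) auto
    moreover have "c' * f \<le> \<alpha> / 4 * c * \<tau> * f"
      using c' f by (intro mult_right_mono) auto
    moreover have "\<alpha> / 2 * \<tau> * c * f = 2 * (\<alpha> / 4 * \<tau> * c * f)" "\<alpha> / 4 * c * \<tau> * f = \<alpha> / 4 * \<tau> * c * f"
      by simp_all
    ultimately show ?thesis by linarith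
  qed
  have 2: "b * b' * inner h h \<le> 0"
    using pos b(2) unfolding b(1) by (intro mult_nonpos_nonneg mult_nonneg_nonpos) auto
  have 3: "a * \<pi> * R * b * inner x h
      = a * \<alpha> / 4 * (\<omega> * \<tau>) * (inner x x + inner h h - inner xs xs)"
  proof -
    have "a * \<pi> * R * b = a * \<alpha> / 2 * (\<omega> * \<tau>)"
      unfolding b(1) \<omega>_def by (simp add: power2_eq_square)
    moreover have "inner x h = (inner x x + inner h h - inner xs xs) / 2"
      unfolding h_def by (simp add: inner_simps inner_commute)
    ultimately show ?thesis by (simp only:)
  qed
  \<comment> \<open>The assumption on the square of \<open>b'\<close> is exactly the discriminant
    condition for these two weights.\<close>
  have 4: "b' * inner h (R *\<^sub>R u)
      \<le> a * \<alpha> / 64 * (\<omega> * \<tau>) * inner h h + \<alpha> / 16 * \<tau> * inner (R *\<^sub>R u) (R *\<^sub>R u)"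
    using pos b(3) by (intro inner_young) (auto simp: power2_eq_square algebra_simps)
  \<comment> \<open>Writing \<open>v = u - \<beta> G\<close> separates a square in \<open>u\<close>
    from a cross term. Half of the square absorbs the cross term, and the lower bound on
    \<open>m\<close> turns the other half into decay.\<close>
  have 5: "- (R * m * inner u v)
      \<le> - (\<alpha> / 8 * \<tau> * inner (R *\<^sub>R u) (R *\<^sub>R u)) + \<beta> * c / 4 * inner G G"
  proof -
    have m0: "m \<ge> 0" using m(1) pos by (smt (verit) mult_pos_pos divide_pos_pos)
    have "(\<beta> * R * m) * inner u G \<le> (R * m / 2) * inner u u + (\<beta>\<^sup>2 * R * m / 2) * inner G G"
      using pos m0 by (intro inner_young) (auto simp: power2_eq_square algebra_simps)
    moreover have "\<beta>\<^sup>2 * R * m / 2 * inner G G \<le> \<beta> * c / 4 * inner G G"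
    proof (rule mult_right_mono)
      have "\<beta> * (\<beta> * R * m) \<le> \<beta> * (c / 2)"
        using m(2) pos by (intro mult_left_mono) auto
      then show "\<beta>\<^sup>2 * R * m / 2 \<le> \<beta> * c / 4" by (simp add: power2_eq_square algebra_simps)
    qed simp
    moreover have "\<alpha> / 8 * \<tau> * inner (R *\<^sub>R u) (R *\<^sub>R u) \<le> R * m / 2 * inner u u"
    proof -
      have "R * (\<alpha> / 4 * R * \<tau>) / 2 * inner u u \<le> R * m / 2 * inner u u"
        using m(1) pos by (intro mult_right_mono divide_right_mono mult_left_mono) auto
      then show ?thesis by (simp add: algebra_simps)
    qed
    moreover have "R * m * inner u v = R * m * inner u u - (\<beta> * R * m) * inner u G"
      unfolding u_def by (simp add: inner_simps inner_commute algebra_simps)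
    moreover have "R * m * inner u u = 2 * (R * m / 2 * inner u u)" by simp
    ultimately show ?thesis by linarith
  qed
  have 6: "- (a * \<beta> * \<omega>) * inner x G \<le> a * \<alpha> / 16 * (\<omega> * \<tau>) * inner x x + \<beta> * c / 4 * inner G G"
  proof (rule inner_young)
    have "(a * \<beta> * \<omega> / 16) * (16 * a * \<beta> * \<omega>) \<le> (a * \<beta> * \<omega> / 16) * (\<alpha> * \<tau> * c)"
      using \<omega>(2) pos by (intro mult_left_mono) auto
    then have "(a * \<beta> * \<omega>)\<^sup>2 \<le> (a * \<beta> * \<omega> / 16) * (\<alpha> * \<tau> * c)"
      by (simp add: power2_eq_square algebra_simps)
    also have "\<dots> = 4 * (a * \<alpha> / 16 * (\<omega> * \<tau>)) * (\<beta> * c / 4)"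
      by simp
    finally show "(- (a * \<beta> * \<omega>))\<^sup>2 \<le> 4 * (a * \<alpha> / 16 * (\<omega> * \<tau>)) * (\<beta> * c / 4)" by simp
  qed (use pos in auto)
  have 7: "\<xi>' / 2 * inner h h \<le> a * \<alpha> / 4 * (\<omega> * \<tau>) * inner h h"
    using \<xi> by (intro mult_right_mono) auto
  have 8: "a / 2 * \<omega>' * inner x x \<le> 0"
    using \<omega>(1) pos by (intro mult_nonpos_nonneg mult_nonneg_nonpos) auto
  \<comment> \<open>Estimate 7 uses up the whole decay of \<open>inner h h\<close> in 3, so the
    remainder from 4 moves to \<open>x\<close> and \<open>xs\<close>: the coefficients of
    \<open>inner x x\<close> then add up to \<open>- 1/4 + 1/16 + 1/32\<close> of
    \<open>a \<alpha> \<omega> \<tau>\<close>, below \<open>- 1/8\<close>.\<close>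
  have 9: "a * \<alpha> / 64 * (\<omega> * \<tau>) * inner h h
      \<le> a * \<alpha> / 64 * (\<omega> * \<tau>) * (2 * inner x x + 2 * inner xs xs)"
    unfolding h_def using pos by (intro mult_left_mono inner_diff_self_le) auto
  have 10: "0 \<le> \<beta> * c * inner G G" "0 \<le> a * \<alpha> * (\<omega> * \<tau>) * inner x x"
    "0 \<le> a * \<alpha> * (\<omega> * \<tau>) * inner xs xs"
    using pos by auto
  show ?thesis
    using 1 2 3 4 5 6 7 8 9 10 by (simp add: algebra_simps)
qed

text \<open>With \<open>w = R u\<close>, this bounds the energy by the quantities that decay in
  \<open>energy_dissipation\<close>, up to a term in \<open>xs\<close>, so that the dissipation
  dominates a multiple of the energy.\<close>

lemma energy_le:
  fixes x xs u :: "'a::real_inner"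
  assumes "0 \<le> b" "b \<le> \<alpha> / 2" "\<xi> \<le> \<alpha>\<^sup>2 / 4" "\<omega> \<le> 1" "a > 0"
  shows "c * f + inner (b *\<^sub>R (x - xs) + w) (b *\<^sub>R (x - xs) + w) / 2
      + a / 2 * \<omega> * inner x x + \<xi> / 2 * inner (x - xs) (x - xs)
    \<le> c * f + inner w w + (3 * \<alpha>\<^sup>2 / 4 + a / 2) * inner x x + 3 * \<alpha>\<^sup>2 / 4 * inner xs xs"
proof -
  define h where "h = x - xs"
  have hh: "inner h h \<le> 2 * inner x x + 2 * inner xs xs"
    unfolding h_def by (rule inner_diff_self_le)
  have "inner (b *\<^sub>R h + w) (b *\<^sub>R h + w) \<le> 2 * (b\<^sup>2 * inner h h) + 2 * inner w w"
    using inner_diff_self_le[of "b *\<^sub>R h" "- w"] by (simp add: power2_eq_square)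
  moreover have "b\<^sup>2 * inner h h \<le> (\<alpha>\<^sup>2 * inner h h) / 4"
    using mult_right_mono[OF power_mono[OF assms(2,1), of 2], of "inner h h"]
    by (simp add: power_divide)
  moreover have "\<xi> / 2 * inner h h \<le> (\<alpha>\<^sup>2 * inner h h) / 8"
    using mult_right_mono[OF assms(3), of "inner h h"] by simp
  moreover have "\<alpha>\<^sup>2 * inner h h \<le> \<alpha>\<^sup>2 * (2 * inner x x + 2 * inner xs xs)"
    by (intro mult_left_mono hh) auto
  moreover have "a / 2 * \<omega> * inner x x \<le> a / 2 * 1 * inner x x"
    using assms by (intro mult_right_mono mult_left_mono) auto
  moreover have "\<alpha>\<^sup>2 * (2 * inner x x + 2 * inner xs xs)
      = 2 * (\<alpha>\<^sup>2 * inner x x) + 2 * (\<alpha>\<^sup>2 * inner xs xs)"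
    "(3 * \<alpha>\<^sup>2 / 4 + a / 2) * inner x x = 3 / 4 * (\<alpha>\<^sup>2 * inner x x) + a / 2 * 1 * inner x x"
    "3 * \<alpha>\<^sup>2 / 4 * inner xs xs = 3 / 4 * (\<alpha>\<^sup>2 * inner xs xs)"
    by (simp_all add: algebra_simps)
  ultimately show ?thesis unfolding h_def[symmetric] by linarith
qed

section \<open>Derivative and boundedness of the energy along a trajectory\<close>

text \<open>After the last time in \<open>{T..t}\<close> with \<open>E <= B\<close> the function
  stays above \<open>B\<close> and therefore cannot increase, so it cannot have risen above
  \<open>B\<close> at time \<open>t\<close>.\<close>

lemma bounded_if_dissipative:
  fixes E :: "real \<Rightarrow> real"
  assumes E': "\<And>t. t \<ge> T \<Longrightarrow> (E has_real_derivative E' t) (at t)"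
    and dissip: "\<And>t. t \<ge> T \<Longrightarrow> E t > B \<Longrightarrow> E' t \<le> 0"
    and init: "E T \<le> B" and t: "t \<ge> T"
  shows "E t \<le> B"
proof (rule ccontr)
  assume "\<not> E t \<le> B"
  define S where "S = {s \<in> {T..t}. E s \<le> B}"
  have cont: "continuous_on {T..t} E"
    using E' by (intro DERIV_continuous_on[of _ _ E'] DERIV_subset[OF E']) auto
  have "closed S"
    unfolding S_def using continuous_closed_preimage[OF cont, of "{..B}"]
    by (simp add: vimage_def Int_def)
  moreover have S: "T \<in> S" "bdd_above S" using init t unfolding S_def by (auto intro!: bdd_aboveI)
  ultimately have sup: "Sup S \<in> S" using closed_contains_Sup by blast
  then have le: "T \<le> Sup S" "Sup S \<le> t" "E (Sup S) \<le> B" unfolding S_def by auto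
  have above: "E s > B" if "Sup S < s" "s \<le> t" for s
    using cSup_upper[of s S] S(2) that le unfolding S_def by force
  have "E t \<le> E (Sup S)"
  proof (rule DERIV_nonpos_imp_decreasing_open[OF le(2)])
    fix s assume "Sup S < s" "s < t"
    then show "\<exists>y. (E has_real_derivative y) (at s) \<and> y \<le> 0"
      using E'[of s] dissip[of s] above[of s] le by auto
  qed (use le continuous_on_subset[OF cont] in auto)
  with le \<open>\<not> E t \<le> B\<close> show False by simp
qed

lemma has_real_derivative_inner_self:
  fixes y :: "real \<Rightarrow> 'a::real_inner"
  assumes "(y has_vector_derivative y') (at t)"
  shows "((\<lambda>t. inner (y t) (y t)) has_real_derivative 2 * inner (y t) y') (at t)"
proof -
  have "((\<lambda>t. inner (y t) (y t)) has_derivative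
      (\<lambda>s. inner (y t) (s *\<^sub>R y') + inner (s *\<^sub>R y') (y t))) (at t)"
    using assms unfolding has_vector_derivative_def by (intro has_derivative_inner) auto
  then show ?thesis
    unfolding has_field_derivative_def
    by (rule has_derivative_eq_rhs) (auto simp: inner_commute)
qed

text \<open>The lower bounds on \<open>\<delta> t\<close> and the smallness conditions on powers of \<open>t\<close> hold for all large \<open>t\<close>;
  \<open>r\<close> is the decay exponent of the velocity, \<open>q\<close> or \<open>p / 2\<close>.\<close>

locale tikhonov_flow =
  fixes x v G :: "real \<Rightarrow> 'a::real_inner" and xs :: 'a and f \<delta> \<delta>' :: "real \<Rightarrow> real"
    and T \<alpha> \<beta> a p q r K :: real
  assumes T: "T \<ge> 1"
    and pos: "\<alpha> > 0" "\<beta> > 0" "a > 0"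
    and exps: "0 < r" "r \<le> q" "q < 1" "2 * r \<le> p" "q < p"
    and x_deriv: "\<And>t. t \<ge> T \<Longrightarrow> (x has_vector_derivative v t) (at t)"
    and u_deriv: "\<And>t. t \<ge> T \<Longrightarrow> ((\<lambda>t. v t + \<beta> *\<^sub>R G t) has_vector_derivative
      - ((\<alpha> * t powr (-q)) *\<^sub>R v t) - \<delta> t *\<^sub>R G t - (a * t powr (-p)) *\<^sub>R x t) (at t)"
    and f_deriv: "\<And>t. t \<ge> T \<Longrightarrow> (f has_real_derivative inner (G t) (v t)) (at t)"
    and \<delta>_deriv: "\<And>t. t \<ge> T \<Longrightarrow> (\<delta> has_real_derivative \<delta>' t) (at t)"
    and f_nonneg: "\<And>t. t \<ge> T \<Longrightarrow> 0 \<le> f t"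
    and f_le: "\<And>t. t \<ge> T \<Longrightarrow> f t \<le> inner (G t) (x t - xs)"
    and \<delta>_large: "\<And>t. t \<ge> T \<Longrightarrow> 1 \<le> \<delta> t" "\<And>t. t \<ge> T \<Longrightarrow> 2 * \<beta> * r \<le> \<delta> t"
      "\<And>t. t \<ge> T \<Longrightarrow> 2 * \<alpha> * \<beta> \<le> \<delta> t" "\<And>t. t \<ge> T \<Longrightarrow> 32 * a * \<beta> \<le> \<alpha> * \<delta> t"
    and \<delta>_growth: "\<And>t. t \<ge> T \<Longrightarrow> t * \<delta>' t \<le> K * \<delta> t"
    and small: "\<And>t. t \<ge> T \<Longrightarrow> r * t powr (q - 1) \<le> \<alpha> / 4"
      "\<And>t. t \<ge> T \<Longrightarrow> (2 * r + K + \<beta> * r) * t powr (q - 1) \<le> \<alpha> / 8"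
      "\<And>t. t \<ge> T \<Longrightarrow> r * (1 + q - 2 * r) * t powr (p - 2) \<le> a"
      "\<And>t. t \<ge> T \<Longrightarrow> 64 * (q - r)\<^sup>2 * t powr (p - 2) \<le> a"
begin

text \<open>With \<open>R = t powr r\<close> and \<open>\<tau> = t powr (-q)\<close>, these are the
  coefficients of the energy lemmas: \<open>b\<close> is half the scaled friction
  \<open>\<alpha> R \<tau>\<close>, \<open>m = \<alpha> R \<tau> - R' - b\<close> and
  \<open>\<xi> = m b\<close>. They are written as sums of powers so that the primed functions, their
  derivatives, can be read off termwise.\<close>

definition b where "b t = \<alpha> / 2 * t powr (r - q)"
definition b' where "b' t = \<alpha> / 2 * ((r - q) * t powr (r - q - 1))"
definition m where "m t = \<alpha> / 2 * t powr (r - q) - r * t powr (r - 1)"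
definition \<xi> where "\<xi> t = \<alpha>\<^sup>2 / 4 * t powr (2 * r - 2 * q) - \<alpha> * r / 2 * t powr (2 * r - q - 1)"
definition \<xi>' where "\<xi>' t = \<alpha>\<^sup>2 / 4 * ((2 * r - 2 * q) * t powr (2 * r - 2 * q - 1))
  - \<alpha> * r / 2 * ((2 * r - q - 1) * t powr (2 * r - q - 2))"
definition \<omega> where "\<omega> t = t powr (2 * r - p)"
definition \<omega>' where "\<omega>' t = (2 * r - p) * t powr (2 * r - p - 1)"
definition c where "c t = t powr (2 * r) * \<delta> t - \<beta> * r * t powr (2 * r - 1)"
definition c' where "c' t = 2 * r * t powr (2 * r - 1) * \<delta> t + t powr (2 * r) * \<delta>' t
  - \<beta> * r * ((2 * r - 1) * t powr (2 * r - 2))"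
definition u where "u t = v t + \<beta> *\<^sub>R G t"
definition h where "h t = x t - xs"
definition W where "W t = b t *\<^sub>R h t + (t powr r) *\<^sub>R u t"
definition E where "E t = c t * f t + inner (W t) (W t) / 2 + a / 2 * \<omega> t * inner (x t) (x t)
  + \<xi> t / 2 * inner (h t) (h t)"

text \<open>These are the hypotheses of \<open>energy_derivative_identity\<close> and
  \<open>energy_dissipation\<close>. Once all powers are products of a few positive quantities, they
  reduce to the assumptions \<open>\<delta>_large\<close>, \<open>\<delta>_growth\<close> and
  \<open>small\<close>.\<close>

lemma coefficients:
  assumes t: "t \<ge> T"
  defines "R \<equiv> t powr r" and "\<tau> \<equiv> t powr (-q)" and "\<pi> \<equiv> t powr (-p)"
  shows "b t = \<alpha> / 2 * R * \<tau>" "b' t \<le> 0" "(b' t)\<^sup>2 \<le> a * \<alpha>\<^sup>2 / 256 * \<omega> t * \<tau>\<^sup>2"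
    "m t = \<alpha> * \<tau> * R - r * t powr (r - 1) - b t"
    "\<alpha> / 4 * R * \<tau> \<le> m t" "m t \<le> \<alpha> / 2 * R * \<tau>" "\<beta> * R * m t \<le> c t / 2"
    "c t = R\<^sup>2 * \<delta> t - \<beta> * R * (r * t powr (r - 1))" "R\<^sup>2 * \<delta> t / 2 \<le> c t" "c t > 0"
    "c' t \<le> \<alpha> / 4 * c t * \<tau>"
    "\<omega> t = R\<^sup>2 * \<pi>" "\<omega> t > 0" "\<omega> t \<le> 1" "\<omega>' t \<le> 0" "16 * a * \<beta> * \<omega> t \<le> \<alpha> * \<tau> * c t"
    "\<xi> t = m t * b t" "\<xi>' t \<le> a * \<alpha> / 2 * (\<omega> t * \<tau>)"
proof -
  \<comment> \<open>\<open>\<tau> * X\<close> is \<open>1 / t\<close> and \<open>\<pi> * Y\<close>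
    is \<open>1 / t^2\<close>. Differentiating a power costs a factor \<open>\<tau> * X\<close>, and
    the surplus \<open>X\<close> or \<open>Y\<close> is what \<open>small\<close> bounds.\<close>
  define X where "X = t powr (q - 1)"
  define Y where "Y = t powr (p - 2)"
  have t1: "t \<ge> 1" "t > 0" using t T by auto
  have pos': "R > 0" "\<tau> > 0" "X > 0" "\<pi> > 0" "\<delta> t > 0" "Y > 0"
    unfolding R_def \<tau>_def X_def \<pi>_def Y_def using t1 \<delta>_large(1)[OF t] by auto
  have powr_le_1: "t powr e \<le> 1" if "e \<le> 0" for e
    using powr_mono[OF that t1(1)] t1 by simp
  have le1: "\<tau> \<le> 1" "\<pi> \<le> \<tau>" "\<tau> * X \<le> 1"
    unfolding R_def \<tau>_def \<pi>_def X_def powr_add[symmetric] using t1 exps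
    by (auto intro!: powr_mono powr_le_1)
  have tX: "t * (\<tau> * X) = 1"
    unfolding \<tau>_def X_def powr_add[symmetric] using t1 by (simp add: powr_minus_divide powr_one)
  have \<pi>Y: "\<pi> * Y = (\<tau> * X)\<^sup>2"
    unfolding \<tau>_def X_def \<pi>_def Y_def powr_add[symmetric] power2_eq_square by simp
  have pw: "t powr (r - 1) = R * \<tau> * X" "t powr (r - q) = R * \<tau>"
    "t powr (r - q - 1) = R * \<tau> * (\<tau> * X)"
    "t powr (2 * r) = R\<^sup>2" "t powr (2 * r - 1) = R\<^sup>2 * (\<tau> * X)"
    "t powr (2 * r - 2) = R\<^sup>2 * (\<tau> * X)\<^sup>2" "t powr (2 * r - p) = R\<^sup>2 * \<pi>"
    "t powr (2 * r - 2 * q) = R\<^sup>2 * \<tau>\<^sup>2" "t powr (2 * r - q - 1) = R\<^sup>2 * \<tau> * (\<tau> * X)"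
    "t powr (2 * r - q - 2) = R\<^sup>2 * \<tau> * (\<tau> * X)\<^sup>2"
    unfolding R_def \<tau>_def X_def \<pi>_def power2_eq_square powr_add[symmetric]
    by (simp_all add: algebra_simps)
  show b: "b t = \<alpha> / 2 * R * \<tau>" unfolding b_def pw by simp
  show "b' t \<le> 0"
    unfolding b'_def using pos exps by (intro mult_nonneg_nonpos mult_nonpos_nonneg) auto
  show \<omega>: "\<omega> t = R\<^sup>2 * \<pi>" "\<omega> t > 0" unfolding \<omega>_def pw using pos' by auto
  show "\<omega> t \<le> 1" unfolding \<omega>_def using exps by (intro powr_le_1) auto
  show "\<omega>' t \<le> 0" unfolding \<omega>'_def using exps by (intro mult_nonpos_nonneg) auto
  show "(b' t)\<^sup>2 \<le> a * \<alpha>\<^sup>2 / 256 * \<omega> t * \<tau>\<^sup>2"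
  proof -
    have "(b' t)\<^sup>2 = \<alpha>\<^sup>2 / 256 * R\<^sup>2 * \<tau>\<^sup>2 * (64 * (q - r)\<^sup>2) * (\<tau> * X)\<^sup>2"
      unfolding b'_def pw by (simp add: power2_eq_square algebra_simps)
    also have "\<dots> = \<alpha>\<^sup>2 / 256 * R\<^sup>2 * \<tau>\<^sup>2 * \<pi> * (64 * (q - r)\<^sup>2 * Y)"
      unfolding \<pi>Y[symmetric] by simp
    also have "\<dots> \<le> \<alpha>\<^sup>2 / 256 * R\<^sup>2 * \<tau>\<^sup>2 * \<pi> * a"
      using small(4)[OF t] pos' unfolding Y_def by (intro mult_left_mono) auto
    finally show ?thesis unfolding \<omega> by (simp add: algebra_simps)
  qed
  show m: "m t = \<alpha> * \<tau> * R - r * t powr (r - 1) - b t"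
    unfolding m_def b_def pw by (simp add: field_simps)
  have m': "m t = R * \<tau> * (\<alpha> / 2 - r * X)"
    unfolding m_def pw by (simp add: algebra_simps)
  show m_ge: "\<alpha> / 4 * R * \<tau> \<le> m t"
  proof -
    have "R * \<tau> * (\<alpha> / 4) \<le> R * \<tau> * (\<alpha> / 2 - r * X)"
      using small(1)[OF t] pos' unfolding X_def by (intro mult_left_mono) auto
    then show ?thesis unfolding m' by (simp add: algebra_simps)
  qed
  show m_le: "m t \<le> \<alpha> / 2 * R * \<tau>"
  proof -
    have "R * \<tau> * (\<alpha> / 2 - r * X) \<le> R * \<tau> * (\<alpha> / 2)"
      using exps pos' by (intro mult_left_mono) auto
    then show ?thesis unfolding m' by (simp add: algebra_simps)
  qed
  show "c t = R\<^sup>2 * \<delta> t - \<beta> * R * (r * t powr (r - 1))"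
    unfolding c_def pw by (simp add: power2_eq_square)
  show c_ge: "R\<^sup>2 * \<delta> t / 2 \<le> c t"
  proof -
    have "(2 * \<beta> * r) * (\<tau> * X) \<le> \<delta> t * 1"
      using le1 \<delta>_large(2)[OF t] pos pos' exps by (intro mult_mono) auto
    then have "R\<^sup>2 * ((2 * \<beta> * r) * (\<tau> * X)) \<le> R\<^sup>2 * (\<delta> t * 1)"
      by (intro mult_left_mono) auto
    then show ?thesis unfolding c_def pw by (simp add: algebra_simps)
  qed
  then show c_pos: "c t > 0" using pos' by (smt (verit) half_gt_zero mult_pos_pos zero_less_power)
  show "\<beta> * R * m t \<le> c t / 2"
  proof -
    have "\<beta> * R * m t \<le> \<beta> * R * (\<alpha> / 2 * R * \<tau>)"
      using m_le pos pos' by (intro mult_left_mono) auto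
    also have "\<dots> = R\<^sup>2 / 4 * ((2 * \<alpha> * \<beta>) * \<tau>)" by (simp add: power2_eq_square)
    also have "\<dots> \<le> R\<^sup>2 / 4 * (\<delta> t * 1)"
      using \<delta>_large(3)[OF t] le1 pos pos' by (intro mult_left_mono mult_mono) auto
    finally show ?thesis using c_ge by simp
  qed
  show "c' t \<le> \<alpha> / 4 * c t * \<tau>"
  proof -
    have \<delta>': "\<delta>' t \<le> K * \<delta> t * (\<tau> * X)"
    proof -
      have "\<delta>' t = (t * (\<tau> * X)) * \<delta>' t" unfolding tX by simp
      also have "\<dots> = (\<tau> * X) * (t * \<delta>' t)" by simp
      also have "\<dots> \<le> (\<tau> * X) * (K * \<delta> t)"
        using \<delta>_growth[OF t] pos' by (intro mult_left_mono) auto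
      finally show ?thesis by (simp add: algebra_simps)
    qed
    have 3: "- ((2 * r - 1) * (\<tau> * X)) \<le> \<delta> t"
    proof -
      have "(1 - 2 * r) * (\<tau> * X) \<le> 1 * 1"
        using le1 pos' exps by (intro mult_mono) auto
      also have "\<dots> \<le> \<delta> t" using \<delta>_large(1)[OF t] by simp
      finally show ?thesis by (simp add: algebra_simps)
    qed
    have "c' t = R\<^sup>2 * (2 * r * (\<tau> * X) * \<delta> t + \<delta>' t
        + \<beta> * r * (\<tau> * X) * (- ((2 * r - 1) * (\<tau> * X))))"
      unfolding c'_def pw by (simp add: power2_eq_square algebra_simps)
    also have "\<dots> \<le> R\<^sup>2 * (2 * r * (\<tau> * X) * \<delta> t + K * \<delta> t * (\<tau> * X) + \<beta> * r * (\<tau> * X) * \<delta> t)"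
      using \<delta>' 3 pos pos' exps by (intro mult_left_mono add_mono) auto
    also have "\<dots> = R\<^sup>2 * \<delta> t * \<tau> * ((2 * r + K + \<beta> * r) * X)" by (simp add: algebra_simps)
    also have "\<dots> \<le> R\<^sup>2 * \<delta> t * \<tau> * (\<alpha> / 8)"
      using small(2)[OF t] pos' unfolding X_def by (intro mult_left_mono) auto
    also have "\<dots> = \<alpha> / 4 * (R\<^sup>2 * \<delta> t / 2) * \<tau>" by simp
    also have "\<dots> \<le> \<alpha> / 4 * c t * \<tau>"
      using c_ge pos pos' by (intro mult_right_mono mult_left_mono) auto
    finally show ?thesis .
  qed
  show "16 * a * \<beta> * \<omega> t \<le> \<alpha> * \<tau> * c t"
  proof -
    have "16 * a * \<beta> * \<omega> t = R\<^sup>2 / 2 * ((32 * a * \<beta>) * \<pi>)" unfolding \<omega> by simp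
    also have "\<dots> \<le> R\<^sup>2 / 2 * ((\<alpha> * \<delta> t) * \<tau>)"
      using pos pos' by (intro mult_left_mono mult_mono[OF \<delta>_large(4)[OF t] le1(2)]) auto
    also have "\<dots> = \<alpha> * \<tau> * (R\<^sup>2 * \<delta> t / 2)" by simp
    also have "\<dots> \<le> \<alpha> * \<tau> * c t"
      using c_ge pos pos' by (intro mult_left_mono) auto
    finally show ?thesis .
  qed
  show "\<xi> t = m t * b t"
    unfolding \<xi>_def m_def b_def pw by (simp add: power2_eq_square algebra_simps)
  show "\<xi>' t \<le> a * \<alpha> / 2 * (\<omega> t * \<tau>)"
  proof -
    \<comment> \<open>As \<open>r <= q\<close>, the leading power in \<open>\<xi>\<close> does not
      increase; only the correction term can make \<open>\<xi>'\<close> positive, and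
      \<open>small(3)\<close> bounds its derivative.\<close>
    have "\<alpha>\<^sup>2 / 4 * ((2 * r - 2 * q) * t powr (2 * r - 2 * q - 1)) \<le> 0"
      using exps by (intro mult_nonneg_nonpos mult_nonpos_nonneg) auto
    then have "\<xi>' t \<le> \<alpha> / 2 * R\<^sup>2 * \<tau> * (r * (1 + q - 2 * r) * (\<tau> * X)\<^sup>2)"
      unfolding \<xi>'_def pw by (simp add: algebra_simps)
    also have "\<dots> = \<alpha> / 2 * R\<^sup>2 * \<tau> * \<pi> * (r * (1 + q - 2 * r) * Y)"
      unfolding \<pi>Y[symmetric] by simp
    also have "\<dots> \<le> \<alpha> / 2 * R\<^sup>2 * \<tau> * \<pi> * a"
      using small(3)[OF t] pos pos' unfolding Y_def by (intro mult_left_mono) auto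
    finally show ?thesis unfolding \<omega> by (simp add: algebra_simps)
  qed
qed

text \<open>The derivative is grouped so that its middle bracket is the left-hand side of
  \<open>energy_derivative_identity\<close>; replacing \<open>\<xi>\<close> by \<open>m * b\<close>
  makes this possible.\<close>

lemma E_deriv:
  assumes t: "t \<ge> T"
  defines "u' \<equiv> - ((\<alpha> * t powr (-q)) *\<^sub>R v t) - \<delta> t *\<^sub>R G t - (a * t powr (-p)) *\<^sub>R x t"
  shows "(E has_real_derivative (c' t * f t
      + (c t * inner (G t) (v t)
        + inner (b t *\<^sub>R h t + (t powr r) *\<^sub>R u t)
            (b' t *\<^sub>R h t + b t *\<^sub>R v t + (r * t powr (r - 1)) *\<^sub>R u t + (t powr r) *\<^sub>R u')
        + a * \<omega> t * inner (x t) (v t) + m t * b t * inner (h t) (v t))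
      + a / 2 * \<omega>' t * inner (x t) (x t) + \<xi>' t / 2 * inner (h t) (h t))) (at t)"
proof -
  have t0: "t > 0" using t T by simp
  have h: "(h has_vector_derivative v t) (at t)"
    unfolding h_def using has_vector_derivative_diff[OF x_deriv[OF t] has_vector_derivative_const] by simp
  have u: "(u has_vector_derivative u') (at t)"
    unfolding u_def u'_def by (rule u_deriv[OF t])
  note P = has_real_derivative_powr[OF t0]
  have b: "(b has_real_derivative b' t) (at t)"
    unfolding b_def b'_def by (intro DERIV_cmult P)
  have \<omega>: "(\<omega> has_real_derivative \<omega>' t) (at t)"
    unfolding \<omega>_def \<omega>'_def by (rule P)
  have c: "(c has_real_derivative c' t) (at t)"
    unfolding c_def c'_def
    by (rule DERIV_cong[OF DERIV_diff[OF DERIV_mult[OF P \<delta>_deriv[OF t]] DERIV_cmult[OF P]]]) simp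
  have \<xi>: "(\<xi> has_real_derivative \<xi>' t) (at t)"
    unfolding \<xi>_def \<xi>'_def
    by (rule DERIV_cong[OF DERIV_diff[OF DERIV_cmult[OF P] DERIV_cmult[OF P]]]) simp
  have W: "(W has_vector_derivative
      (b t *\<^sub>R v t + b' t *\<^sub>R h t) + ((t powr r) *\<^sub>R u' + (r * t powr (r - 1)) *\<^sub>R u t)) (at t)"
    unfolding W_def
    by (intro has_vector_derivative_add has_vector_derivative_scaleR b h P u)
  note D = has_real_derivative_inner_self
  have "(E has_real_derivative c' t * f t + inner (G t) (v t) * c t
      + 2 * inner (W t) ((b t *\<^sub>R v t + b' t *\<^sub>R h t)
          + ((t powr r) *\<^sub>R u' + (r * t powr (r - 1)) *\<^sub>R u t)) / 2
      + ((a / 2 * \<omega>' t) * inner (x t) (x t) + 2 * inner (x t) (v t) * (a / 2 * \<omega> t))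
      + ((\<xi>' t / 2) * inner (h t) (h t) + 2 * inner (h t) (v t) * (\<xi> t / 2))) (at t)"
    unfolding E_def
    by (intro DERIV_add DERIV_mult DERIV_cdivide DERIV_cmult c \<omega> \<xi> f_deriv[OF t]
        D[OF W] D[OF h] D[OF x_deriv[OF t]])
  then show ?thesis
    by (rule DERIV_cong)
      (simp add: W_def coefficients(17)[OF t] inner_commute algebra_simps)
qed

text \<open>\<open>\<kappa>\<close> is chosen so that \<open>\<kappa>\<close> times the coefficients
  of \<open>c * f\<close>, \<open>R u\<close> and \<open>x\<close> in \<open>energy_le\<close> stays
  below their decay rates in \<open>energy_dissipation\<close>; \<open>M\<close> collects the terms
  in \<open>xs\<close> of both lemmas.\<close>

definition \<kappa> where "\<kappa> = min (\<alpha> / 16) ((a * \<alpha> / 8) / (3 * \<alpha>\<^sup>2 / 4 + a / 2))"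
definition M where "M = a * \<alpha> * inner xs xs + \<kappa> * (3 * \<alpha>\<^sup>2 / 4 * inner xs xs)"

lemma \<kappa>: "\<kappa> > 0" "\<kappa> \<le> \<alpha> / 16" "\<kappa> * (3 * \<alpha>\<^sup>2 / 4 + a / 2) \<le> a * \<alpha> / 8"
proof -
  have L: "3 * \<alpha>\<^sup>2 / 4 + a / 2 > 0" using pos by (simp add: add_pos_pos)
  show "\<kappa> > 0" unfolding \<kappa>_def using pos L by simp
  show "\<kappa> \<le> \<alpha> / 16" unfolding \<kappa>_def by (rule min.cobounded1)
  have "\<kappa> \<le> (a * \<alpha> / 8) / (3 * \<alpha>\<^sup>2 / 4 + a / 2)" unfolding \<kappa>_def by simp
  with L show "\<kappa> * (3 * \<alpha>\<^sup>2 / 4 + a / 2) \<le> a * \<alpha> / 8" by (simp only: pos_le_divide_eq)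
qed

text \<open>\<open>c * f\<close> and \<open>R u\<close> decay at rate \<open>\<tau>\<close>, but
  \<open>x\<close> only at rate \<open>\<omega> \<tau>\<close>. As \<open>\<omega> <= 1\<close>, the
  latter serves as a common rate, and \<open>energy_le\<close> converts the three decays into decay
  of \<open>E\<close>.\<close>

lemma E_dissipation:
  assumes t: "t \<ge> T"
  shows "\<exists>D. (E has_real_derivative D) (at t) \<and>
    D \<le> \<omega> t * t powr (-q) * (M - \<kappa> * E t)"
proof -
  let ?R = "t powr r" and ?\<tau> = "t powr (-q)" and ?\<pi> = "t powr (-p)"
  have t0: "t > 0" using t T by simp
  note co = coefficients[OF t]
  have Rpos: "?R > 0" and \<tau>pos: "?\<tau> > 0" using t0 by auto
  define Z where "Z = inner (?R *\<^sub>R u t) (?R *\<^sub>R u t)"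
  define P where "P = inner (x t) (x t)"
  define Q where "Q = inner xs xs"
  have nn: "0 \<le> Z" "0 \<le> P" "0 \<le> Q" unfolding Z_def P_def Q_def by auto
  have wt: "\<omega> t * ?\<tau> > 0" using co(13) t0 by simp
  have wt_le: "\<omega> t * ?\<tau> \<le> ?\<tau>" using co(14) by (simp add: mult_left_le_one_le co(13) less_imp_le)
  let ?D = "c' t * f t
      + (- (c t * \<beta>) * inner (G t) (G t) + b t * b' t * inner (h t) (h t)
        - b t * (?R * \<delta> t - \<beta> * (r * t powr (r - 1))) * inner (G t) (h t)
        - a * ?\<pi> * ?R * b t * inner (x t) (h t) + b' t * inner (h t) (?R *\<^sub>R u t)
        - ?R * m t * inner (u t) (v t) - a * \<beta> * \<omega> t * inner (x t) (G t))
      + a / 2 * \<omega>' t * inner (x t) (x t) + \<xi>' t / 2 * inner (h t) (h t)"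
  have D: "(E has_real_derivative ?D) (at t)"
  proof (rule DERIV_cong[OF E_deriv[OF t]])
    note energy_derivative_identity[where R = ?R and R' = "r * t powr (r - 1)" and \<delta> = "\<delta> t"
        and \<tau> = ?\<tau> and \<pi> = ?\<pi> and b = "b t" and b' = "b' t" and x = "x t" and h = "h t"
        and v = "v t" and G = "G t" and \<alpha> = \<alpha> and \<beta> = \<beta> and a = a,
        folded u_def co(4,8,12)]
    then show "c' t * f t
      + (c t * inner (G t) (v t)
        + inner (b t *\<^sub>R h t + ?R *\<^sub>R u t)
            (b' t *\<^sub>R h t + b t *\<^sub>R v t + (r * t powr (r - 1)) *\<^sub>R u t
              + ?R *\<^sub>R (- ((\<alpha> * ?\<tau>) *\<^sub>R v t) - \<delta> t *\<^sub>R G t - (a * ?\<pi>) *\<^sub>R x t))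
        + a * \<omega> t * inner (x t) (v t) + m t * b t * inner (h t) (v t))
      + a / 2 * \<omega>' t * inner (x t) (x t) + \<xi>' t / 2 * inner (h t) (h t) = ?D"
      by simp
  qed
  have "?D \<le> - (\<alpha> / 4 * ?\<tau> * c t * f t) - \<alpha> / 16 * ?\<tau> * Z
      - a * \<alpha> / 8 * (\<omega> t * ?\<tau>) * P + a * \<alpha> * (\<omega> t * ?\<tau>) * Q"
    unfolding Z_def P_def Q_def
    by (rule energy_dissipation[where R = ?R and R' = "r * t powr (r - 1)" and \<delta> = "\<delta> t"
        and \<tau> = ?\<tau> and \<pi> = ?\<pi> and b = "b t" and b' = "b' t" and x = "x t" and xs = xs
        and v = "v t" and G = "G t" and \<alpha> = \<alpha> and \<beta> = \<beta> and a = a and f = "f t" and m = "m t"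
        and c' = "c' t" and \<omega>' = "\<omega>' t" and \<xi>' = "\<xi>' t",
        folded u_def h_def co(8,12),
        OF Rpos pos \<tau>pos co(13,10) f_nonneg[OF t] f_le[OF t, folded h_def]
          co(1,2,3,5,7,11,15,16,18)])
  also have "\<dots> \<le> - ((\<omega> t * ?\<tau>) * (\<kappa> * (c t * f t))) - (\<omega> t * ?\<tau>) * (\<kappa> * Z)
      - (\<omega> t * ?\<tau>) * (\<kappa> * (3 * \<alpha>\<^sup>2 / 4 + a / 2) * P) + a * \<alpha> * (\<omega> t * ?\<tau>) * Q"
  proof -
    have "(\<omega> t * ?\<tau>) * (\<kappa> * (c t * f t)) \<le> ?\<tau> * (\<alpha> / 4 * (c t * f t))"
      using wt_le \<kappa> pos co(10) f_nonneg[OF t] by (intro mult_mono mult_right_mono) auto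
    moreover have "(\<omega> t * ?\<tau>) * (\<kappa> * Z) \<le> ?\<tau> * (\<alpha> / 16 * Z)"
      using wt_le \<kappa> pos nn by (intro mult_mono mult_right_mono) auto
    moreover have "(\<omega> t * ?\<tau>) * (\<kappa> * (3 * \<alpha>\<^sup>2 / 4 + a / 2) * P) \<le> (\<omega> t * ?\<tau>) * (a * \<alpha> / 8 * P)"
      using wt \<kappa> nn by (intro mult_left_mono mult_right_mono) auto
    moreover have "\<alpha> / 4 * ?\<tau> * c t * f t = ?\<tau> * (\<alpha> / 4 * (c t * f t))"
      "\<alpha> / 16 * ?\<tau> * Z = ?\<tau> * (\<alpha> / 16 * Z)"
      "a * \<alpha> / 8 * (\<omega> t * ?\<tau>) * P = (\<omega> t * ?\<tau>) * (a * \<alpha> / 8 * P)"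
      by simp_all
    ultimately show ?thesis by linarith
  qed
  also have "\<dots> = (\<omega> t * ?\<tau>) * (M - \<kappa> * (c t * f t + Z + (3 * \<alpha>\<^sup>2 / 4 + a / 2) * P + 3 * \<alpha>\<^sup>2 / 4 * Q))"
    unfolding M_def Q_def[symmetric] by (simp add: algebra_simps)
  also have "\<dots> \<le> (\<omega> t * ?\<tau>) * (M - \<kappa> * E t)"
  proof -
    have R\<tau>: "?R * ?\<tau> \<le> 1"
      unfolding powr_add[symmetric] using powr_mono[of "r + - q" 0 t] exps t T by simp
    have b_le: "b t \<le> \<alpha> / 2" "0 \<le> b t"
      unfolding co(1) using R\<tau> pos by (simp_all add: mult_left_le mult.assoc)
    have "\<xi> t \<le> (\<alpha> / 2 * ?R * ?\<tau>) * b t"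
      unfolding co(17) using co(6) b_le by (intro mult_right_mono)
    also have "\<dots> \<le> (\<alpha> / 2) * (\<alpha> / 2)"
      unfolding co(1)[symmetric] using b_le pos by (intro mult_mono) auto
    finally have "\<xi> t \<le> \<alpha>\<^sup>2 / 4" by (simp add: power2_eq_square)
    then have "E t \<le> c t * f t + Z + (3 * \<alpha>\<^sup>2 / 4 + a / 2) * P + 3 * \<alpha>\<^sup>2 / 4 * Q"
      unfolding E_def W_def h_def Z_def P_def Q_def
      using b_le pos co(14) by (intro energy_le) auto
    then show ?thesis
      using wt \<kappa>(1) by (intro mult_left_mono diff_left_mono) auto
  qed
  finally show ?thesis using D by blast
qed

text \<open>Above \<open>M / \<kappa>\<close> the energy cannot increase, hence it stays below
  \<open>B\<close>. The first rate follows from \<open>c >= R^2 \<delta> / 2\<close>, the second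
  from \<open>R u = W - b h\<close> once the energy controls \<open>b h\<close>.\<close>

lemma rates: "\<exists>C. \<forall>t\<ge>T. t powr (2 * r) * \<delta> t * f t \<le> C \<and> t powr r * norm (u t) \<le> C"
proof -
  obtain E' where E': "\<And>t. t \<ge> T \<Longrightarrow> (E has_real_derivative E' t) (at t)"
    "\<And>t. t \<ge> T \<Longrightarrow> E' t \<le> \<omega> t * t powr (-q) * (M - \<kappa> * E t)"
    using E_dissipation by metis
  define B where "B = max (E T) (M / \<kappa>)"
  have E_le: "E t \<le> B" if "t \<ge> T" for t
  proof (rule bounded_if_dissipative[OF E'(1) _ _ that])
    fix s assume s: "s \<ge> T" "E s > B"
    then have "M / \<kappa> < E s" unfolding B_def by simp
    then have "M - \<kappa> * E s \<le> 0" using \<kappa>(1) by (simp add: divide_less_eq mult.commute)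
    then have "\<omega> s * s powr (-q) * (M - \<kappa> * E s) \<le> 0"
      using coefficients(13)[OF s(1)] by (intro mult_nonneg_nonpos) auto
    then show "E' s \<le> 0" using E'(2)[OF s(1)] by simp
  qed (auto simp: B_def)
  have "t powr (2 * r) * \<delta> t * f t \<le> 2 * B \<and> t powr r * norm (u t) \<le> sqrt (12 * B)"
    if t: "t \<ge> T" for t
  proof -
    let ?R = "t powr r"
    note co = coefficients[OF t]
    have t0: "t > 0" using t T by simp
    have b0: "b t \<ge> 0" unfolding co(1) using pos by simp
    \<comment> \<open>\<open>m >= b / 2\<close> gives \<open>b^2 <= 2 m b = 2 \<xi>\<close>, so the
      last energy term controls \<open>b h\<close>.\<close>
    have b2m: "b t \<le> 2 * m t" unfolding co(1) using co(5) by simp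
    then have \<xi>: "(b t)\<^sup>2 \<le> 2 * \<xi> t"
      unfolding co(17) power2_eq_square using mult_right_mono[OF b2m b0] by simp
    then have \<xi>0: "\<xi> t \<ge> 0" by (smt (verit) zero_le_power2)
    have parts: "0 \<le> c t * f t" "0 \<le> inner (W t) (W t)" "0 \<le> a / 2 * \<omega> t * inner (x t) (x t)"
      "0 \<le> \<xi> t / 2 * inner (h t) (h t)"
      using co(10,13) f_nonneg[OF t] \<xi>0 pos by auto
    note E = E_le[OF t, unfolded E_def]
    have "t powr (2 * r) = ?R\<^sup>2" unfolding power2_eq_square powr_add[symmetric] by simp
    then have "t powr (2 * r) * \<delta> t * f t \<le> 2 * (c t * f t)"
      using mult_right_mono[OF co(9) f_nonneg[OF t]] by simp
    also have "\<dots> \<le> 2 * B" using E parts by linarith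
    finally have 1: "t powr (2 * r) * \<delta> t * f t \<le> 2 * B" .
    have "(?R * norm (u t))\<^sup>2 = inner (W t - b t *\<^sub>R h t) (W t - b t *\<^sub>R h t)"
      unfolding W_def by (simp add: power_mult_distrib flip: power2_norm_eq_inner)
    also have "\<dots> \<le> 2 * inner (W t) (W t) + 2 * inner (b t *\<^sub>R h t) (b t *\<^sub>R h t)"
      by (rule inner_diff_self_le)
    also have "inner (b t *\<^sub>R h t) (b t *\<^sub>R h t) \<le> 4 * (\<xi> t / 2 * inner (h t) (h t))"
      using mult_right_mono[OF \<xi>, of "inner (h t) (h t)"] by (simp add: power2_eq_square)
    \<comment> \<open>\<open>W\<close> enters with four times its energy term and \<open>h\<close>
      with eight times; each energy term is at most \<open>B\<close>.\<close>
    also have "2 * inner (W t) (W t) + 2 * (4 * (\<xi> t / 2 * inner (h t) (h t))) \<le> 12 * B"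
      using E parts by linarith
    finally have "?R * norm (u t) \<le> sqrt (12 * B)" by (simp add: real_le_rsqrt)
    with 1 show ?thesis by simp
  qed
  then have "\<forall>t\<ge>T. t powr (2 * r) * \<delta> t * f t \<le> max (2 * B) (sqrt (12 * B)) \<and>
      t powr r * norm (u t) \<le> max (2 * B) (sqrt (12 * B))"
    by (metis max.coboundedI1 max.coboundedI2)
  then show ?thesis by blast
qed

end

subsection \<open>Convergence rates\<close>

lemma eventually_mult_powr_le:
  fixes C e \<epsilon> :: real
  assumes "e < 0" "\<epsilon> > 0"
  shows "\<forall>\<^sub>F t in at_top. C * t powr e \<le> \<epsilon>"
proof -
  have "((\<lambda>t::real. C * t powr e) \<longlongrightarrow> C * 0) at_top"
    by (intro tendsto_mult tendsto_const tendsto_neg_powr[OF assms(1)] filterlim_ident)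
  then have "\<forall>\<^sub>F t in at_top. C * t powr e < \<epsilon>"
    using assms(2) by (intro order_tendstoD) auto
  then show ?thesis by (rule eventually_mono) simp
qed

text \<open>Both cases of the theorem are instances: subject to the condition at
  \<open>p = 2\<close>, \<open>r\<close> may be any positive exponent with \<open>r <= q\<close> and
  \<open>2 * r <= p\<close>, the largest being \<open>q\<close> in case (i) and \<open>p / 2\<close>
  in case (ii).\<close>

lemma solution_rates:
  fixes g :: "'a::{real_inner,complete_space} \<Rightarrow> real"
  assumes g_convex: "convex_on UNIV g"
    and g_diff: "twice_differentiable g"
    and params: "t0 > 0" "\<alpha> > 0" "\<beta> > 0" "a > 0"
    and \<delta>_diff: "\<delta> differentiable_on {t0..}"
    and \<delta>_lim: "filterlim \<delta> at_top at_top"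
    and exps: "0 < r" "r \<le> q" "q < 1" "2 * r \<le> p" "q < p" "p \<le> 2"
    and a_cond: "p = 2 \<Longrightarrow> r = q \<and> a \<ge> q * (1 - q)"
    and \<delta>_growth: "\<exists>K1. \<forall>\<^sub>F t in at_top. t * dot t0 \<delta> t < K1 * \<delta> t"
    and sol: "global_solution g \<delta> \<alpha> \<beta> a p q t0 x0 v0 x"
    and xs: "xs \<in> argmin g"
  shows "(\<lambda>t. g (x t) - g xs) \<in> O[at_top](\<lambda>t. 1 / (\<delta> t * t powr (2 * r)))" (is ?P)
    and "(\<lambda>t. norm (dot t0 x t + \<beta> *\<^sub>R gradient g (x t))) \<in> O[at_top](\<lambda>t. 1 / t powr r)" (is ?Q)
proof -
  obtain K where K: "\<forall>\<^sub>F t in at_top. t * dot t0 \<delta> t < K * \<delta> t" using \<delta>_growth by blast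
  \<comment> \<open>For \<open>p < 2\<close> the power tends to 0; for \<open>p = 2\<close> it is 1
    and the constant itself must be at most \<open>a\<close>. There \<open>r = q\<close>, so the two
    constants used are \<open>q * (1 - q)\<close> and 0, which is where the assumption on
    \<open>a\<close> enters.\<close>
  have small_p: "\<forall>\<^sub>F t in at_top. C * t powr (p - 2) \<le> a"
    if "p = 2 \<Longrightarrow> C \<le> a" for C
  proof (cases "p = 2")
    case True
    have "C * t powr (p - 2) \<le> a" if "t > 0" for t
      using that True \<open>p = 2 \<Longrightarrow> C \<le> a\<close> by simp
    then show ?thesis by (intro eventually_mono[OF eventually_gt_at_top[of 0]])
  next
    case False
    then show ?thesis using exps params by (intro eventually_mult_powr_le) auto
  qed
  have \<delta>_ge: "\<forall>\<^sub>F t in at_top. C \<le> \<delta> t" for C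
    using \<delta>_lim unfolding filterlim_at_top by blast
  \<comment> \<open>\<open>t >= 1\<close> bounds powers with nonpositive exponents by 1, and
    \<open>t >= t0 + 1\<close> stays away from the one-sided derivatives at
    \<open>t0\<close>.\<close>
  have "\<forall>\<^sub>F t in at_top. t \<ge> max 1 (t0 + 1) \<and> 1 \<le> \<delta> t \<and> 2 * \<beta> * r \<le> \<delta> t \<and> 2 * \<alpha> * \<beta> \<le> \<delta> t
      \<and> 32 * a * \<beta> / \<alpha> \<le> \<delta> t \<and> t * dot t0 \<delta> t < K * \<delta> t \<and> r * t powr (q - 1) \<le> \<alpha> / 4
      \<and> (2 * r + K + \<beta> * r) * t powr (q - 1) \<le> \<alpha> / 8
      \<and> r * (1 + q - 2 * r) * t powr (p - 2) \<le> a \<and> 64 * (q - r)\<^sup>2 * t powr (p - 2) \<le> a"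
    using exps params a_cond
    by (intro eventually_conj eventually_ge_at_top \<delta>_ge K eventually_mult_powr_le small_p) auto
  then obtain T where "\<forall>t\<ge>T. t \<ge> max 1 (t0 + 1) \<and> 1 \<le> \<delta> t \<and> 2 * \<beta> * r \<le> \<delta> t \<and> 2 * \<alpha> * \<beta> \<le> \<delta> t
      \<and> 32 * a * \<beta> / \<alpha> \<le> \<delta> t \<and> t * dot t0 \<delta> t < K * \<delta> t \<and> r * t powr (q - 1) \<le> \<alpha> / 4
      \<and> (2 * r + K + \<beta> * r) * t powr (q - 1) \<le> \<alpha> / 8
      \<and> r * (1 + q - 2 * r) * t powr (p - 2) \<le> a \<and> 64 * (q - r)\<^sup>2 * t powr (p - 2) \<le> a"
    unfolding eventually_at_top_linorder by blast
  then have late: "t \<ge> 1" "t > t0" "1 \<le> \<delta> t" "2 * \<beta> * r \<le> \<delta> t" "2 * \<alpha> * \<beta> \<le> \<delta> t"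
      "32 * a * \<beta> / \<alpha> \<le> \<delta> t" "t * dot t0 \<delta> t < K * \<delta> t" "r * t powr (q - 1) \<le> \<alpha> / 4"
      "(2 * r + K + \<beta> * r) * t powr (q - 1) \<le> \<alpha> / 8"
      "r * (1 + q - 2 * r) * t powr (p - 2) \<le> a" "64 * (q - r)\<^sup>2 * t powr (p - 2) \<le> a"
    if "t \<ge> T" for t
    using that by force+
  have gmin: "g xs \<le> g y" for y
    using xs unfolding argmin_def is_arg_min_def by (auto simp: not_less)
  have gdiff: "g differentiable (at y)" for y
    using g_diff unfolding twice_differentiable_def by blast
  interpret tikhonov_flow x "dot t0 x" "\<lambda>t. gradient g (x t)" xs "\<lambda>t. g (x t) - g xs" \<delta> "dot t0 \<delta>"
    T \<alpha> \<beta> a p q r K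
  proof (unfold_locales)
    fix t assume t: "t \<ge> T"
    note t0 = late(2)[OF t]
    show x': "(x has_vector_derivative dot t0 x t) (at t)"
      by (rule solution_has_derivative[OF g_diff \<delta>_diff params(1) sol t0])
    show "((\<lambda>t. dot t0 x t + \<beta> *\<^sub>R gradient g (x t)) has_vector_derivative
      - ((\<alpha> * t powr (-q)) *\<^sub>R dot t0 x t) - \<delta> t *\<^sub>R gradient g (x t)
      - (a * t powr (-p)) *\<^sub>R x t) (at t)"
      using solution_classical[OF g_diff \<delta>_diff params(1) sol t0]
      by (simp add: powr_minus_divide)
    have "((\<lambda>t. g (x t)) has_derivative (\<lambda>s. inner (s *\<^sub>R dot t0 x t) (gradient g (x t)))) (at t)"
      using has_derivative_compose[OF x'[unfolded has_vector_derivative_def]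
          gradient_works[OF gdiff, unfolded gderiv_def]] .
    then have "((\<lambda>t. g (x t)) has_real_derivative inner (gradient g (x t)) (dot t0 x t)) (at t)"
      unfolding has_field_derivative_def
      by (rule has_derivative_eq_rhs) (auto simp: inner_commute)
    then show "((\<lambda>t. g (x t) - g xs) has_real_derivative inner (gradient g (x t)) (dot t0 x t)) (at t)"
      using DERIV_diff[OF _ DERIV_const] by fastforce
    have at: "at t within {t0..} = at t"
      using t0 by (intro at_within_interior) (auto simp: interior_real_atLeast)
    then have "\<delta> differentiable (at t)"
      using \<delta>_diff t0 unfolding differentiable_on_def by (metis atLeast_iff less_imp_le)
    then show "(\<delta> has_real_derivative dot t0 \<delta> t) (at t)"
      using vector_derivative_works[of \<delta> "at t"]
      unfolding dot_def at has_real_derivative_iff_has_vector_derivative by simp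
    show "0 \<le> g (x t) - g xs" using gmin by simp
    show "g (x t) - g xs \<le> inner (gradient g (x t)) (x t - xs)"
      by (rule convex_gradient_ineq[OF g_convex gdiff])
    show "32 * a * \<beta> \<le> \<alpha> * \<delta> t"
      using late(6)[OF t] params by (simp add: divide_le_eq mult.commute)
    show "t * dot t0 \<delta> t \<le> K * \<delta> t" using late(7)[OF t] by simp
  qed (use params exps late in auto)
  obtain C where C: "\<And>t. t \<ge> T \<Longrightarrow> t powr (2 * r) * \<delta> t * (g (x t) - g xs) \<le> C"
    "\<And>t. t \<ge> T \<Longrightarrow> t powr r * norm (dot t0 x t + \<beta> *\<^sub>R gradient g (x t)) \<le> C"
    using rates unfolding u_def by blast
  show ?P
  proof (rule bigoI[of _ C], rule eventually_mono[OF eventually_ge_at_top[of T]])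
    fix t assume t: "t \<ge> T"
    then have "\<delta> t > 0" "t powr (2 * r) > 0" using late(1,3)[OF t] by auto
    then show "norm (g (x t) - g xs) \<le> C * norm (1 / (\<delta> t * t powr (2 * r)))"
      using C(1)[OF t] gmin[of "x t"] by (simp add: pos_le_divide_eq abs_mult ac_simps)
  qed
  show ?Q
  proof (rule bigoI[of _ C], rule eventually_mono[OF eventually_ge_at_top[of T]])
    fix t assume t: "t \<ge> T"
    then have "t powr r > 0" using late(1)[OF t] by auto
    then show "norm (norm (dot t0 x t + \<beta> *\<^sub>R gradient g (x t))) \<le> C * norm (1 / t powr r)"
      using C(2)[OF t] by (simp add: pos_le_divide_eq ac_simps)
  qed
qed

theorem theorem3p1:
  fixes g :: "'a::{real_inner,complete_space} \<Rightarrow> real"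
    and \<delta> :: "real \<Rightarrow> real"
    and \<alpha> \<beta> a p q t0 :: real
    and x0 v0 :: 'a
    and x :: "real \<Rightarrow> 'a"
    and xs :: 'a
  assumes g_convex: "convex_on UNIV g"
    and g_diff: "twice_differentiable g"
    and params: "t0 > 0" "\<alpha> > 0" "\<beta> > 0" "a > 0" "p > 0" "0 < q" "q < 1"
    and \<delta>_pos: "\<And>t. t \<ge> t0 \<Longrightarrow> \<delta> t > 0"
    and \<delta>_diff: "\<delta> differentiable_on {t0..}"
    and \<delta>_mono: "mono_on {t0..} \<delta>"
    and \<delta>_lim: "filterlim \<delta> at_top at_top"
    and p_range: "q < p" "p \<le> 2"
    and a_cond: "p = 2 \<Longrightarrow> a \<ge> q * (1 - q)"
    and \<delta>_growth: "\<exists>K1>0. \<forall>\<^sub>F t in at_top. t * dot t0 \<delta> t < K1 * \<delta> t"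
    and sol: "global_solution g \<delta> \<alpha> \<beta> a p q t0 x0 v0 x"
    and xs: "xs \<in> argmin g"
  shows "(2 * q < p \<and> p \<le> 2 \<longrightarrow>
            (\<lambda>t. g (x t) - g xs) \<in> O[at_top](\<lambda>t. 1 / (\<delta> t * t powr (2 * q))) \<and>
            (\<lambda>t. norm (dot t0 x t + \<beta> *\<^sub>R gradient g (x t))) \<in> O[at_top](\<lambda>t. 1 / t powr q)) \<and>
         (q < p \<and> p \<le> 2 * q \<longrightarrow>
            (\<lambda>t. g (x t) - g xs) \<in> O[at_top](\<lambda>t. 1 / (\<delta> t * t powr p)) \<and>
            (\<lambda>t. norm (dot t0 x t + \<beta> *\<^sub>R gradient g (x t))) \<in> O[at_top](\<lambda>t. 1 / t powr (p / 2)))"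
proof (intro conjI impI; elim conjE)
  assume r: "2 * q < p"
  note rates = solution_rates[OF g_convex g_diff params(1-4) \<delta>_diff \<delta>_lim params(6) order_refl
      params(7) less_imp_le[OF r] p_range _ _ sol xs]
  show "(\<lambda>t. g (x t) - g xs) \<in> O[at_top](\<lambda>t. 1 / (\<delta> t * t powr (2 * q)))"
    "(\<lambda>t. norm (dot t0 x t + \<beta> *\<^sub>R gradient g (x t))) \<in> O[at_top](\<lambda>t. 1 / t powr q)"
    using rates a_cond \<delta>_growth by blast+
next
  assume r: "p \<le> 2 * q"
  \<comment> \<open>Here \<open>r = p / 2\<close>. Since \<open>p <= 2 * q < 2\<close>, the case
    \<open>p = 2\<close> cannot occur, which discharges the implication that would demand
    \<open>r = q\<close>.\<close>
  then have "p / 2 \<le> q" "p \<noteq> 2" using params(7) by auto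
  note rates = solution_rates[OF g_convex g_diff params(1-4) \<delta>_diff \<delta>_lim _ this(1)
      params(7) _ p_range _ _ sol xs]
  show "(\<lambda>t. g (x t) - g xs) \<in> O[at_top](\<lambda>t. 1 / (\<delta> t * t powr p))"
    "(\<lambda>t. norm (dot t0 x t + \<beta> *\<^sub>R gradient g (x t))) \<in> O[at_top](\<lambda>t. 1 / t powr (p / 2))"
    using rates \<open>p \<noteq> 2\<close> params(5) \<delta>_growth by auto
qed

end
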